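(* Let $r\ge 2$ and let $F=K_{a_1,\ldots,a_r}$ be a strongly unbalanced complete partite graph. Then for all $k>r$, all part sizes of $W_{F,k}$ are distinct; that is, whenever a complete $\ell$-partite graphon $W[x_1,\ldots,x_\ell]$ with $\ell<k$ attains $i_k(F)$, the numbers $x_1,\ldots,x_\ell$ are pairwise distinct. Similarly, $i(F)$ is attained by a complete partite graphon $W_F$, and all part sizes of $W_F$ are distinct; that is, whenever a complete $\ell$-partite graphon $W[x_1,\ldots,x_\ell]$ attains $i(F)$, the numbers $x_1,\ldots,x_\ell$ are pairwise distinct.
   Context: All graphs are finite and simple. $K_{a_1,\ldots,a_r}$ is the complete $r$-partite graph with part sizes $a_1\ge\cdots\ge a_r\ge 1$; it is called strongly unbalanced if $(a_i-a_j)^2>a_i+a_j$ for all $1\le i<j\le r$. For graphs $F,G$, $P(F,G)$ is the number of $|V(F)|$-subsets of $V(G)$ inducing a subgraph isomorphic to $F$, and $p(F,G)=P(F,G)/\binom{|V(G)|}{|V(F)|}$. $i(F,n)$ is the maximum of $p(F,G)$ over all $n$-vertex graphs $G$, and $i_k(F,n)$ is the maximum over all $n$-vertex graphs not containing $K_k$ as a subgraph; $i(F)=\lim_{n\to\infty}i(F,n)$ and $i_k(F)=\lim_{n\to\infty}i_k(F,n)$ (the limits exist). For $x_1,\ldots,x_\ell>0$ with $\sum x_i=1$ ($\ell$ a positive integer), the complete $\ell$-partite graphon $W[x_1,\ldots,x_\ell]:[0,1]^2\to\{0,1\}$ is obtained by partitioning $[0,1]$ into intervals of lengths $x_1,\ldots,x_\ell$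 (the part sizes) and setting $W(x,y)=1$ iff $x,y$ lie in distinct intervals. The induced density of $F$ in $W$ is the probability that $|V(F)|$ independent uniform points of $[0,1]$ induce a copy of $F$, where distinct $u,v$ are adjacent iff $W(u,v)=1$. $i_k(F)$ (respectively $i(F)$) is attained by $W$ if the induced density of $F$ in $W$ equals $i_k(F)$ (respectively $i(F)$). For a complete partite graph $F$, $i_k(F)$ is attained by some complete $\ell$-partite graphon with $\ell<k$; $W_{F,k}$ denotes such a graphon (possibly non-unique). *)

theory Defs
  imports "HOL-Probability.Probability" "HOL-Library.Ramsey"
begin

section \<open>Finite simple graphs\<close>

type_synonym 'a graph = "'a set \<times> 'a set set"

abbreviation verts :: "'a graph \<Rightarrow> 'a set" where "verts G \<equiv> fst G"
abbreviation edges :: "'a graph \<Rightarrow> 'a set set" where "edges G \<equiv> snd G"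

definition simple_graph :: "'a graph \<Rightarrow> bool" where
  "simple_graph G \<longleftrightarrow> finite (verts G) \<and> edges G \<subseteq> nsets (verts G) 2"

definition graph_iso :: "'a graph \<Rightarrow> 'b graph \<Rightarrow> bool" where
  "graph_iso F G \<longleftrightarrow> (\<exists>f. bij_betw f (verts F) (verts G) \<and>
     (\<forall>u\<in>verts F. \<forall>v\<in>verts F. {u, v} \<in> edges F \<longleftrightarrow> {f u, f v} \<in> edges G))"

definition induced_subgraph :: "'a graph \<Rightarrow> 'a set \<Rightarrow> 'a graph" where
  "induced_subgraph G S = (S, {e \<in> edges G. e \<subseteq> S})"

definition contains_K :: "nat \<Rightarrow> 'a graph \<Rightarrow> bool" where
  "contains_K k G \<longleftrightarrow> (\<exists>S \<subseteq> verts G. card S = k \<and> clique S (edges G))"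

text \<open>The vertex \<open>(i, j)\<close> is the \<open>j\<close>-th vertex of the \<open>i\<close>-th part (counting from 0).\<close>

definition complete_partite :: "nat list \<Rightarrow> (nat \<times> nat) graph" where
  "complete_partite a =
     ({(i, j). i < length a \<and> j < a ! i},
      {{(i, j), (i', j')} | i j i' j'.
         i < length a \<and> j < a ! i \<and> i' < length a \<and> j' < a ! i' \<and> i \<noteq> i'})"

definition strongly_unbalanced :: "nat list \<Rightarrow> bool" where
  "strongly_unbalanced a \<longleftrightarrow>
     (\<forall>i j. i < j \<and> j < length a \<longrightarrow> (int (a ! i) - int (a ! j))\<^sup>2 > int (a ! i) + int (a ! j))"

section \<open>Induced densities and inducibility\<close>

definition induced_count :: "'a graph \<Rightarrow> 'b graph \<Rightarrow> nat" where
  "induced_count F G =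
     card {S. S \<subseteq> verts G \<and> card S = card (verts F) \<and> graph_iso F (induced_subgraph G S)}"

definition induced_density :: "'a graph \<Rightarrow> 'b graph \<Rightarrow> real" where
  "induced_density F G =
     real (induced_count F G) / real (card (verts G) choose card (verts F))"

text \<open>
  Induced densities are invariant under isomorphism, so the maximum over all \<open>n\<close>-vertex graphs
  is taken over the (finitely many) graphs with vertex set \<open>{..<n}\<close>.
\<close>

definition inducibility_n :: "'a graph \<Rightarrow> nat \<Rightarrow> real" where
  "inducibility_n F n =
     Max {induced_density F G | G :: nat graph. simple_graph G \<and> verts G = {..<n}}"

definition K_free_inducibility_n :: "nat \<Rightarrow> 'a graph \<Rightarrow> nat \<Rightarrow> real" where
  "K_free_inducibility_n k F n =
     Max {induced_density F G | G :: nat graph.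
            simple_graph G \<and> verts G = {..<n} \<and> \<not> contains_K k G}"

definition inducibility :: "'a graph \<Rightarrow> real" where
  "inducibility F = lim (inducibility_n F)"

definition K_free_inducibility :: "nat \<Rightarrow> 'a graph \<Rightarrow> real" where
  "K_free_inducibility k F = lim (K_free_inducibility_n k F)"

section \<open>Complete partite graphons\<close>

definition part_sizes :: "real list \<Rightarrow> bool" where
  "part_sizes x \<longleftrightarrow> (\<forall>t\<in>set x. t > 0) \<and> sum_list x = 1"

text \<open>The last interval is closed, so that the intervals partition the whole of \<open>{0..1}\<close>.\<close>

definition part_interval :: "real list \<Rightarrow> nat \<Rightarrow> real set" where
  "part_interval x i =
     (if Suc i = length x
      then {sum_list (take i x) .. sum_list (take (Suc i) x)}
      else {sum_list (take i x) ..< sum_list (take (Suc i) x)})"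

definition partite_graphon :: "real list \<Rightarrow> real \<Rightarrow> real \<Rightarrow> real" where
  "partite_graphon x s t =
     (if \<exists>i<length x. \<exists>j<length x. i \<noteq> j \<and> s \<in> part_interval x i \<and> t \<in> part_interval x j
      then 1 else 0)"

text \<open>
  The graph induced by the points \<open>\<omega> 0, \<dots>, \<omega> (m - 1)\<close>; the vertices are the indices of the points,
  because the points themselves are only almost surely distinct.
\<close>

definition sample_graph :: "(real \<Rightarrow> real \<Rightarrow> real) \<Rightarrow> nat \<Rightarrow> (nat \<Rightarrow> real) \<Rightarrow> nat graph" where
  "sample_graph W m \<omega> = ({..<m}, {{u, v} | u v. u < m \<and> v < m \<and> u \<noteq> v \<and> W (\<omega> u) (\<omega> v) = 1})"

definition uniform_points :: "nat \<Rightarrow> (nat \<Rightarrow> real) measure" where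
  "uniform_points m = Pi\<^sub>M {..<m} (\<lambda>_. uniform_measure lborel {0..1})"

definition graphon_density :: "'a graph \<Rightarrow> (real \<Rightarrow> real \<Rightarrow> real) \<Rightarrow> real" where
  "graphon_density F W =
     measure (uniform_points (card (verts F)))
       {\<omega> \<in> space (uniform_points (card (verts F))).
          graph_iso F (sample_graph W (card (verts F)) \<omega>)}"

end

theory Submission
  imports Defs
begin

text \<open>
  Let \<open>a\<close> be the list of part sizes of \<open>F\<close>. The proof has four ingredients.

  A density formula. Two parts of \<open>F\<close> of equal size would violate strong unbalancedness, so the parts
  of \<open>F\<close> have pairwise distinct sizes. If a sample from a complete partite graphon induces \<open>F\<close>,
  then the sizes of its colour classes tell which part of the graphon hosts which part of \<open>F\<close>.
  Hence the density of \<open>F\<close> in \<open>W[x]\<close> is a positive constant, depending on \<open>a\<close> only, times the sum of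
  \<open>\<Prod>i. x (\<phi> i) ^ a i\<close> over all injections \<open>\<phi>\<close> from the parts of \<open>F\<close> to the parts of \<open>W[x]\<close>
  (\<open>colour_density_eq_inj_sum\<close>, \<open>graphon_density_eq_colour_density\<close>).

  Inducibilities as suprema. Colouring \<open>n\<close> vertices independently with colour probabilities \<open>x\<close>
  gives a complete partite graph whose expected density of \<open>F\<close> is that of \<open>W[x]\<close>
  (\<open>expected_induced_count\<close>). For a matching upper bound, Zykov symmetrization turns an optimal
  graph into a complete partite one: two nonadjacent vertices of a copy of \<open>F\<close> have the same
  neighbours in that copy, so for nonadjacent \<open>u\<close> and \<open>v\<close>, replacing one of them by a clone of the
  other does, for at least one of the two choices, not destroy copies of \<open>F\<close> on balance, and it never
  creates a larger clique (\<open>exists_symmetrized_maximizer\<close>). In a complete partite graph the number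
  of copies is at most \<open>n ^ m / m!\<close> times the density of \<open>F\<close> in the graphon with the same part
  proportions, where \<open>m\<close> is the number of vertices of \<open>F\<close>. So both
  inducibilities are suprema of densities of complete partite graphons
  (\<open>K_free_inducibility_eq_Sup\<close>, \<open>inducibility_eq_Sup\<close>).

  Distinctness. Suppose that two parts have equal size \<open>t\<close>, and change them to \<open>t * (1 + e)\<close> and
  \<open>t * (1 - e)\<close>. The terms of the polynomial in which at most one of the two parts is used do not
  decrease in total, by convexity. If the two parts host parts of \<open>F\<close> of sizes \<open>a\<close> and \<open>b\<close>, the two
  ways of doing so contribute together \<open>t ^ (a + b)\<close> times
  \<open>(1 + e) ^ a * (1 - e) ^ b + (1 + e) ^ b * (1 - e) ^ a = 2 + ((a - b)\<^sup>2 - (a + b)) * e\<^sup>2 + \<dots>\<close>,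
  which for small \<open>e\<close> exceeds the original value exactly because \<open>(a - b)\<^sup>2 > a + b\<close>. So an optimal
  graphon cannot have equal parts (\<open>inj_sum_less_perturbed\<close>).

  Existence of a maximizer without a bound on the number of parts. Let \<open>r\<close> be the number of parts of
  \<open>F\<close>. At most one of them has size 1, so a density bounded away from 0 forces at least \<open>r - 1\<close> parts of
  the graphon to be larger than some constant (\<open>many_big_parts\<close>). If there are very many parts, two
  of them are tiny, of sizes \<open>u\<close> and \<open>v\<close>. Merging them gains, for every part of \<open>F\<close> of size
  \<open>k \<ge> 2\<close>, at least a constant times \<open>u ^ (k - 1) * v + u * v ^ (k - 1)\<close>, since the other \<open>r - 1\<close>
  parts of \<open>F\<close> fit into the big parts. What is lost are the placements with different parts of
  \<open>F\<close> in the two tiny parts; as one of these parts of \<open>F\<close> has size at least 2, the loss is smaller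
  than the gain by a factor of the order of \<open>u + v\<close> (\<open>inj_sum_merge_tiny_parts\<close>). So a bounded number
  of parts suffices, and a maximum exists by compactness (\<open>inj_sum_attains_maximum\<close>).
\<close>

section \<open>Colour graphs and copies of a complete partite graph\<close>

text \<open>
  Complete partite graphs are represented by colourings, the parts being the colour classes, so that a
  random complete partite graph is just a random function.
\<close>

definition colour_graph :: "'v set \<Rightarrow> ('v \<Rightarrow> nat) \<Rightarrow> 'v graph" where
  "colour_graph V c = (V, {{u, v} | u v. u \<in> V \<and> v \<in> V \<and> c u \<noteq> c v})"

lemma verts_colour_graph [simp]: "verts (colour_graph V c) = V"
  by (simp add: colour_graph_def)

lemma edge_colour_graph:
  "{u, v} \<in> edges (colour_graph V c) \<longleftrightarrow> u \<in> V \<and> v \<in> V \<and> c u \<noteq> c v"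
  unfolding colour_graph_def by (auto simp: doubleton_eq_iff)

lemma verts_complete_partite: "verts (complete_partite a) = Sigma {..<length a} (\<lambda>i. {..<a ! i})"
  by (auto simp: complete_partite_def)

lemma finite_verts_complete_partite [simp]: "finite (verts (complete_partite a))"
  by (simp add: verts_complete_partite)

lemma edge_complete_partite:
  "{p, q} \<in> edges (complete_partite a) \<longleftrightarrow>
     p \<in> verts (complete_partite a) \<and> q \<in> verts (complete_partite a) \<and> fst p \<noteq> fst q"
  unfolding complete_partite_def by (cases p; cases q) (auto simp: doubleton_eq_iff)

lemma graph_isoI:
  assumes "bij_betw f (verts F) (verts G)"
    and "\<And>u v. u \<in> verts F \<Longrightarrow> v \<in> verts F \<Longrightarrow> {u, v} \<in> edges F \<longleftrightarrow> {f u, f v} \<in> edges G"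
  shows "graph_iso F G"
  using assms unfolding graph_iso_def by blast

lemma graph_iso_sym:
  assumes "graph_iso F G" shows "graph_iso G F"
proof -
  obtain f where f: "bij_betw f (verts F) (verts G)"
    and e: "\<And>u v. u \<in> verts F \<Longrightarrow> v \<in> verts F \<Longrightarrow> {u, v} \<in> edges F \<longleftrightarrow> {f u, f v} \<in> edges G"
    using assms unfolding graph_iso_def by blast
  let ?g = "inv_into (verts F) f"
  have "bij_betw ?g (verts G) (verts F)" using f by (rule bij_betw_inv_into)
  moreover have "{u, v} \<in> edges G \<longleftrightarrow> {?g u, ?g v} \<in> edges F"
    if "u \<in> verts G" "v \<in> verts G" for u v
    using that e[of "?g u" "?g v"] f bij_betwE[OF calculation]
    by (simp add: bij_betw_inv_into_right)
  ultimately show ?thesis unfolding graph_iso_def by blast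
qed

lemma graph_iso_trans:
  assumes "graph_iso F G" "graph_iso G H" shows "graph_iso F H"
proof -
  obtain f where f: "bij_betw f (verts F) (verts G)"
    and e: "\<And>u v. u \<in> verts F \<Longrightarrow> v \<in> verts F \<Longrightarrow> {u, v} \<in> edges F \<longleftrightarrow> {f u, f v} \<in> edges G"
    using assms(1) unfolding graph_iso_def by blast
  obtain g where g: "bij_betw g (verts G) (verts H)"
    and e': "\<And>u v. u \<in> verts G \<Longrightarrow> v \<in> verts G \<Longrightarrow> {u, v} \<in> edges G \<longleftrightarrow> {g u, g v} \<in> edges H"
    using assms(2) unfolding graph_iso_def by blast
  have "bij_betw (g \<circ> f) (verts F) (verts H)" using f g by (rule bij_betw_trans)
  moreover have "{u, v} \<in> edges F \<longleftrightarrow> {(g \<circ> f) u, (g \<circ> f) v} \<in> edges H"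
    if "u \<in> verts F" "v \<in> verts F" for u v
    using that e e' bij_betwE[OF f] by simp
  ultimately show ?thesis unfolding graph_iso_def by blast
qed

lemma graph_iso_cong:
  assumes "graph_iso G H" shows "graph_iso F G \<longleftrightarrow> graph_iso F H"
  using graph_iso_trans[of F G H] graph_iso_trans[of F H G] graph_iso_sym[of G H] assms by auto

lemma graph_iso_colour_graph_reindex:
  assumes "bij_betw h V V'"
  shows "graph_iso (colour_graph V (\<lambda>v. c (h v))) (colour_graph V' c)"
proof (rule graph_isoI[of h])
  show "bij_betw h (verts (colour_graph V (\<lambda>v. c (h v)))) (verts (colour_graph V' c))"
    using assms by simp
qed (use bij_betwE[OF assms] in \<open>simp add: edge_colour_graph\<close>)

lemma nth_pos:
  assumes "\<forall>t\<in>set a. t \<ge> 1" "i < length a" shows "(a :: nat list) ! i > 0"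
  using assms by (auto simp: Suc_le_eq)

text \<open>
  A map assigns to every vertex the index of the part of \<open>F\<close> that it belongs to. The number of these
  maps is the multinomial coefficient by which the density differs from the polynomial \<open>inj_sum\<close>.
\<close>

definition part_maps :: "nat list \<Rightarrow> 'v set \<Rightarrow> ('v \<Rightarrow> nat) set" where
  "part_maps a V = {b \<in> V \<rightarrow>\<^sub>E {..<length a}. \<forall>i<length a. card {v \<in> V. b v = i} = a ! i}"

lemma graph_iso_complete_partite_if:
  assumes "finite V" and b: "b \<in> part_maps a V" and \<phi>: "inj_on \<phi> {..<length a}"
    and c: "\<And>v. v \<in> V \<Longrightarrow> c v = \<phi> (b v)"
  shows "graph_iso (complete_partite a) (colour_graph V c)"
proof -
  have bV: "b v < length a" if "v \<in> V" for v using b that by (auto simp: part_maps_def)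
  have "\<exists>h. bij_betw h {v \<in> V. b v = i} {..<a ! i}" if "i < length a" for i
    using b that \<open>finite V\<close> by (intro finite_same_card_bij) (auto simp: part_maps_def)
  then obtain h where h: "\<And>i. i < length a \<Longrightarrow> bij_betw (h i) {v \<in> V. b v = i} {..<a ! i}"
    by metis
  define g where "g v = (b v, h (b v) v)" for v
  have inj: "inj_on g V"
  proof
    fix u v assume "u \<in> V" "v \<in> V" "g u = g v"
    then show "u = v"
      using bij_betw_imp_inj_on[OF h[OF bV[of u]]] by (auto simp: g_def inj_on_def)
  qed
  have "g ` V = verts (complete_partite a)"
  proof (intro equalityI subsetI)
    fix p assume "p \<in> g ` V"
    then obtain v where v: "v \<in> V" "p = g v" by auto
    then have "h (b v) v < a ! (b v)" using bij_betwE[OF h[OF bV]] by auto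
    then show "p \<in> verts (complete_partite a)" using v bV by (auto simp: verts_complete_partite g_def)
  next
    fix p assume p: "p \<in> verts (complete_partite a)"
    then have "fst p < length a" "snd p \<in> {..<a ! fst p}" by (auto simp: verts_complete_partite)
    then have "snd p \<in> h (fst p) ` {v \<in> V. b v = fst p}"
      using bij_betw_imp_surj_on[OF h] by simp
    then obtain v where "v \<in> V" "b v = fst p" "h (fst p) v = snd p" by auto
    then show "p \<in> g ` V" by (intro image_eqI[of _ _ v]) (auto simp: g_def)
  qed
  then have g: "bij_betw g V (verts (complete_partite a))"
    using inj by (simp add: bij_betw_def)
  have "c u \<noteq> c v \<longleftrightarrow> fst (g u) \<noteq> fst (g v)" if "u \<in> V" "v \<in> V" for u v
    using that \<phi> bV c by (auto simp: g_def inj_on_def)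
  then have "graph_iso (colour_graph V c) (complete_partite a)"
    using g bij_betwE[OF g]
    by (intro graph_isoI[of g]) (simp_all add: edge_colour_graph edge_complete_partite)
  then show ?thesis by (rule graph_iso_sym)
qed

text \<open>
  An isomorphism maps the parts of \<open>F\<close> to the colour classes of \<open>V\<close>: \<open>b\<close> gives the part of \<open>F\<close> that a
  vertex comes from, and \<open>\<phi>\<close> the colour of that part, read off at its first vertex. Such a vertex exists
  because the parts are nonempty.
\<close>

lemma graph_iso_complete_partiteE:
  assumes "graph_iso (complete_partite a) (colour_graph V c)" and pos: "\<forall>t\<in>set a. t \<ge> 1"
  obtains b \<phi> where "b \<in> part_maps a V" "\<phi> \<in> extensional {..<length a}" "inj_on \<phi> {..<length a}"
    "\<And>v. v \<in> V \<Longrightarrow> c v = \<phi> (b v)"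
proof -
  let ?F = "complete_partite a"
  obtain g where g: "bij_betw g (verts ?F) V"
    and e: "\<And>p q. p \<in> verts ?F \<Longrightarrow> q \<in> verts ?F \<Longrightarrow>
              {p, q} \<in> edges ?F \<longleftrightarrow> {g p, g q} \<in> edges (colour_graph V c)"
    using assms(1) unfolding graph_iso_def by auto
  have e': "fst p \<noteq> fst q \<longleftrightarrow> c (g p) \<noteq> c (g q)" if "p \<in> verts ?F" "q \<in> verts ?F" for p q
    using e[OF that] that bij_betwE[OF g] by (auto simp: edge_colour_graph edge_complete_partite)
  have root: "(i, 0) \<in> verts ?F" if "i < length a" for i
    using nth_pos[OF pos that] that by (simp add: verts_complete_partite)
  define k where "k = inv_into (verts ?F) g"
  have k: "k v \<in> verts ?F" "g (k v) = v" if "v \<in> V" for v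
    using that g bij_betwE[OF bij_betw_inv_into[OF g]]
    by (auto simp: k_def bij_betw_inv_into_right)
  define b where "b = (\<lambda>v\<in>V. fst (k v))"
  define \<phi> where "\<phi> = (\<lambda>i\<in>{..<length a}. c (g (i, 0)))"
  have bV: "b v < length a" if "v \<in> V" for v
    using k(1)[OF that] that by (auto simp: b_def verts_complete_partite)
  have "card {v \<in> V. b v = i} = a ! i" if "i < length a" for i
  proof -
    have "bij_betw g ({i} \<times> {..<a ! i}) {v \<in> V. b v = i}"
    proof (rule bij_betwI')
      fix p q assume "p \<in> {i} \<times> {..<a ! i}" "q \<in> {i} \<times> {..<a ! i}"
      then show "g p = g q \<longleftrightarrow> p = q"
        using that bij_betw_imp_inj_on[OF g] by (auto simp: inj_on_def verts_complete_partite)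
    next
      fix p assume p: "p \<in> {i} \<times> {..<a ! i}"
      then have "p \<in> verts ?F" using that by (auto simp: verts_complete_partite)
      then show "g p \<in> {v \<in> V. b v = i}"
        using g p bij_betwE[OF g] by (auto simp: b_def k_def bij_betw_inv_into_left)
    next
      fix v assume "v \<in> {v \<in> V. b v = i}"
      then show "\<exists>p\<in>{i} \<times> {..<a ! i}. v = g p"
        using k[of v] by (intro bexI[of _ "k v"]) (auto simp: b_def verts_complete_partite)
    qed
    then show ?thesis by (auto dest: bij_betw_same_card)
  qed
  then have "b \<in> part_maps a V" using bV by (auto simp: part_maps_def b_def)
  moreover have "\<phi> \<in> extensional {..<length a}" by (simp add: \<phi>_def)
  moreover have "inj_on \<phi> {..<length a}"
    using e'[OF root root] by (auto simp: inj_on_def \<phi>_def)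
  moreover have "c v = \<phi> (b v)" if "v \<in> V" for v
  proof -
    have "fst (k v) < length a" using bV[OF that] that by (simp add: b_def)
    then show ?thesis
      using e'[OF k(1)[OF that] root[of "fst (k v)"]] that bV k by (auto simp: \<phi>_def b_def)
  qed
  ultimately show ?thesis by (rule that)
qed

lemma part_maps_nonempty:
  assumes "finite V" "card V = card (verts (complete_partite a))"
  shows "part_maps a V \<noteq> {}"
proof -
  obtain g where g: "bij_betw g V (verts (complete_partite a))"
    using assms finite_same_card_bij[of V "verts (complete_partite a)"] by auto
  define b where "b = (\<lambda>v\<in>V. fst (g v))"
  have "card {v \<in> V. b v = i} = a ! i" if "i < length a" for i
  proof -
    have "bij_betw g {v \<in> V. b v = i} ({i} \<times> {..<a ! i})"
      unfolding bij_betw_def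
    proof
      show "inj_on g {v \<in> V. b v = i}"
        using bij_betw_imp_inj_on[OF g] by (rule inj_on_subset) auto
      show "g ` {v \<in> V. b v = i} = {i} \<times> {..<a ! i}"
      proof (intro equalityI subsetI)
        fix p assume "p \<in> g ` {v \<in> V. b v = i}"
        then show "p \<in> {i} \<times> {..<a ! i}"
          using bij_betwE[OF g] by (fastforce simp: b_def verts_complete_partite)
      next
        fix p assume p: "p \<in> {i} \<times> {..<a ! i}"
        then have "p \<in> g ` V"
          using bij_betw_imp_surj_on[OF g] that by (auto simp: verts_complete_partite)
        then obtain v where "v \<in> V" "p = g v" by auto
        then show "p \<in> g ` {v \<in> V. b v = i}" using p by (intro image_eqI[of _ _ v]) (auto simp: b_def)
      qed
    qed
    then show ?thesis by (auto dest: bij_betw_same_card)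
  qed
  moreover have "b \<in> V \<rightarrow>\<^sub>E {..<length a}"
    using bij_betwE[OF g] by (fastforce simp: b_def verts_complete_partite)
  ultimately show ?thesis unfolding part_maps_def by blast
qed

section \<open>The density of a complete partite graph as a polynomial in the part sizes\<close>

text \<open>
  If \<open>x\<close> is a probability distribution on \<open>I\<close>, this is the probability that colouring the vertices of
  \<open>V\<close> independently according to \<open>x\<close> gives a copy of \<open>F\<close>.
\<close>

definition colour_density :: "'a graph \<Rightarrow> 'v set \<Rightarrow> nat set \<Rightarrow> (nat \<Rightarrow> real) \<Rightarrow> real" where
  "colour_density F V I x =
     (\<Sum>c \<in> {c \<in> V \<rightarrow>\<^sub>E I. graph_iso F (colour_graph V c)}. \<Prod>v\<in>V. x (c v))"

text \<open>
  Part sizes indexed by an arbitrary finite set, so that parts can be removed or merged without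
  renumbering.
\<close>

definition profile :: "nat set \<Rightarrow> (nat \<Rightarrow> real) \<Rightarrow> bool" where
  "profile I x \<longleftrightarrow> finite I \<and> (\<forall>q\<in>I. x q > 0) \<and> sum x I = 1"

definition injections :: "nat set \<Rightarrow> nat set \<Rightarrow> (nat \<Rightarrow> nat) set" where
  "injections R I = {\<phi> \<in> R \<rightarrow>\<^sub>E I. inj_on \<phi> R}"

definition inj_sum :: "(nat \<Rightarrow> nat) \<Rightarrow> nat set \<Rightarrow> nat set \<Rightarrow> (nat \<Rightarrow> real) \<Rightarrow> real" where
  "inj_sum a R I x = (\<Sum>\<phi>\<in>injections R I. \<Prod>i\<in>R. x (\<phi> i) ^ a i)"

text \<open>
  A colouring that gives a copy of \<open>F\<close> factors uniquely through the parts of \<open>F\<close>. Uniqueness is where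
  the sizes must be distinct: otherwise two parts of equal size could be exchanged.
\<close>

lemma bij_betw_part_maps:
  assumes "finite V" and pos: "\<forall>t\<in>set a. t \<ge> 1" and "distinct a"
  shows "bij_betw (\<lambda>(\<phi>, b). \<lambda>v\<in>V. \<phi> (b v)) (injections {..<length a} I \<times> part_maps a V)
           {c \<in> V \<rightarrow>\<^sub>E I. graph_iso (complete_partite a) (colour_graph V c)}"
    (is "bij_betw ?f (?J \<times> ?B) ?C")
proof (rule bij_betwI')
  fix p q assume "p \<in> ?J \<times> ?B" "q \<in> ?J \<times> ?B"
  then obtain \<phi> b \<psi> d where pq: "p = (\<phi>, b)" "q = (\<psi>, d)"
    and inj: "\<phi> \<in> ?J" "\<psi> \<in> ?J" and b: "b \<in> ?B" "d \<in> ?B" by auto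
  show "?f p = ?f q \<longleftrightarrow> p = q"
  proof
    assume eq: "?f p = ?f q"
    have eq: "\<phi> (b v) = \<psi> (d v)" if "v \<in> V" for v
      using fun_cong[OF eq, of v] that by (simp add: pq)
    have bd: "b v < length a" "d v < length a" if "v \<in> V" for v
      using b that by (auto simp: part_maps_def)
    have inj': "inj_on \<phi> {..<length a}" "inj_on \<psi> {..<length a}"
      using inj by (auto simp: injections_def)
    \<comment> \<open>The size of a colour class identifies the part of \<open>F\<close> that it hosts.\<close>
    have same: "b v = d v" if v: "v \<in> V" for v
    proof -
      have "b u = b v \<longleftrightarrow> d u = d v" if u: "u \<in> V" for u
      proof -
        have "b u = b v \<longleftrightarrow> \<phi> (b u) = \<phi> (b v)"
          using inj_on_eq_iff[OF inj'(1)] bd u v by simp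
        also have "\<dots> \<longleftrightarrow> d u = d v"
          using inj_on_eq_iff[OF inj'(2)] bd u v eq by simp
        finally show ?thesis .
      qed
      then have "{u \<in> V. b u = b v} = {u \<in> V. d u = d v}" by blast
      moreover have "card {u \<in> V. b u = b v} = a ! b v" "card {u \<in> V. d u = d v} = a ! d v"
        using b bd v by (auto simp: part_maps_def)
      ultimately show ?thesis
        using \<open>distinct a\<close> bd v by (simp add: nth_eq_iff_index_eq)
    qed
    have "\<phi> i = \<psi> i" if i: "i < length a" for i
    proof -
      have "card {v \<in> V. b v = i} \<noteq> 0"
        using b nth_pos[OF pos i] i by (auto simp: part_maps_def)
      then obtain v where "v \<in> V" "b v = i" by (metis (mono_tags, lifting) Collect_empty_eq card.empty)
      then show ?thesis using eq same by auto
    qed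
    then have "\<phi> = \<psi>"
      using inj by (intro PiE_ext[where k = "{..<length a}" and s = "\<lambda>_. I"]) (auto simp: injections_def)
    moreover have "b = d"
      using b same by (intro PiE_ext[where k = V and s = "\<lambda>_. {..<length a}"]) (auto simp: part_maps_def)
    ultimately show "p = q" by (simp add: pq)
  qed simp
next
  fix p assume "p \<in> ?J \<times> ?B"
  then obtain \<phi> b where p: "p = (\<phi>, b)" "\<phi> \<in> ?J" "b \<in> ?B" by auto
  then have "graph_iso (complete_partite a) (colour_graph V (?f p))"
    using \<open>finite V\<close>
    by (intro graph_iso_complete_partite_if[of _ b _ \<phi>]) (auto simp: injections_def)
  then show "?f p \<in> ?C" using p by (fastforce simp: injections_def part_maps_def)
next
  fix c assume c: "c \<in> ?C"
  then obtain b \<phi> where b: "b \<in> ?B" and \<phi>: "\<phi> \<in> extensional {..<length a}"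
      "inj_on \<phi> {..<length a}" and eq: "\<And>v. v \<in> V \<Longrightarrow> c v = \<phi> (b v)"
    using pos by (auto elim!: graph_iso_complete_partiteE)
  have "\<phi> i \<in> I" if i: "i < length a" for i
  proof -
    have "card {v \<in> V. b v = i} \<noteq> 0"
      using b nth_pos[OF pos i] i by (auto simp: part_maps_def)
    then obtain v where "v \<in> V" "b v = i" by (metis (mono_tags, lifting) Collect_empty_eq card.empty)
    moreover from this have "c v \<in> I" using c by auto
    ultimately show ?thesis using eq by auto
  qed
  then have "\<phi> \<in> ?J" using \<phi> by (simp add: injections_def PiE_iff)
  moreover have "c = ?f (\<phi>, b)"
    using eq c by (auto simp: fun_eq_iff PiE_iff extensional_def)
  ultimately show "\<exists>p\<in>?J \<times> ?B. c = ?f p" using b by blast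
qed

lemma colour_density_eq_inj_sum:
  assumes "finite V" "\<forall>t\<in>set a. t \<ge> 1" "distinct a"
  shows "colour_density (complete_partite a) V I x =
           real (card (part_maps a V)) * inj_sum (\<lambda>i. a ! i) {..<length a} I x"
proof -
  let ?J = "injections {..<length a} I" and ?B = "part_maps a V"
  have "colour_density (complete_partite a) V I x =
        (\<Sum>p\<in>?J \<times> ?B. \<Prod>v\<in>V. x ((case p of (\<phi>, b) \<Rightarrow> \<lambda>v\<in>V. \<phi> (b v)) v))"
    unfolding colour_density_def
    by (rule sum.reindex_bij_betw[OF bij_betw_part_maps[OF assms], symmetric])
  also have "\<dots> = (\<Sum>\<phi>\<in>?J. \<Sum>b\<in>?B. \<Prod>v\<in>V. x (\<phi> (b v)))"
    by (subst sum.cartesian_product) (auto intro!: sum.cong prod.cong)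
  also have "\<dots> = (\<Sum>\<phi>\<in>?J. \<Sum>b\<in>?B. \<Prod>i<length a. x (\<phi> i) ^ (a ! i))"
  proof (intro sum.cong refl)
    fix \<phi> b assume b: "b \<in> ?B"
    then have "(\<Prod>i<length a. \<Prod>v\<in>{v \<in> V. b v = i}. x (\<phi> (b v))) = (\<Prod>v\<in>V. x (\<phi> (b v)))"
      using \<open>finite V\<close> by (intro prod.group) (auto simp: part_maps_def)
    moreover have "(\<Prod>v\<in>{v \<in> V. b v = i}. x (\<phi> (b v))) = x (\<phi> i) ^ (a ! i)"
      if "i < length a" for i
      using b that by (simp add: part_maps_def)
    ultimately show "(\<Prod>v\<in>V. x (\<phi> (b v))) = (\<Prod>i<length a. x (\<phi> i) ^ (a ! i))" by simp
  qed
  finally show ?thesis by (simp add: inj_sum_def sum_distrib_left)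
qed

lemma finite_part_maps: "finite V \<Longrightarrow> finite (part_maps a V)"
  by (rule finite_subset[of _ "V \<rightarrow>\<^sub>E {..<length a}"]) (auto simp: part_maps_def intro: finite_PiE)

lemma card_part_maps_pos:
  assumes "finite V" "card V = card (verts (complete_partite a))"
  shows "card (part_maps a V) > 0"
  using part_maps_nonempty[OF assms] finite_part_maps[OF assms(1)] by (simp add: card_gt_0_iff)

text \<open>
  Only the number of sampled vertices matters, not their names; this compares the copies of \<open>F\<close> on
  different vertex sets of the same size.
\<close>

lemma colour_density_reindex:
  assumes h: "bij_betw h V V'"
  shows "colour_density F V I x = colour_density F V' I x"
proof -
  let ?k = "inv_into V h"
  have k: "bij_betw ?k V' V" using h by (rule bij_betw_inv_into)
  have hk: "h (?k v) = v" if "v \<in> V'" for v using h that by (simp add: bij_betw_inv_into_right)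
  have kh: "?k (h v) = v" if "v \<in> V" for v using h that by (simp add: bij_betw_inv_into_left)
  have "(\<Sum>c \<in> {c \<in> V' \<rightarrow>\<^sub>E I. graph_iso F (colour_graph V' c)}. \<Prod>v\<in>V'. x (c v)) =
        (\<Sum>c \<in> {c \<in> V \<rightarrow>\<^sub>E I. graph_iso F (colour_graph V c)}. \<Prod>v\<in>V. x (c v))"
  proof (rule sum.reindex_bij_witness[of _ "\<lambda>c. \<lambda>v\<in>V'. c (?k v)" "\<lambda>c. \<lambda>v\<in>V. c (h v)"], goal_cases)
    case (1 c)
    then show ?case
      using hk bij_betwE[OF k] by (intro ext) (auto simp: PiE_iff extensional_def)
  next
    case (2 c)
    have "colour_graph V (\<lambda>v\<in>V. c (h v)) = colour_graph V (\<lambda>v. c (h v))"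
      unfolding colour_graph_def by auto
    then show ?case using 2 graph_iso_cong[OF graph_iso_colour_graph_reindex[OF h, of c], of F] bij_betwE[OF h]
      by (auto simp: PiE_iff)
  next
    case (3 c)
    then show ?case
      using kh bij_betwE[OF h] by (intro ext) (auto simp: PiE_iff extensional_def)
  next
    case (4 c)
    have "colour_graph V' (\<lambda>v\<in>V'. c (?k v)) = colour_graph V' (\<lambda>v. c (?k v))"
      unfolding colour_graph_def by auto
    then show ?case using 4 graph_iso_cong[OF graph_iso_colour_graph_reindex[OF k, of c], of F] bij_betwE[OF k]
      by (auto simp: PiE_iff)
  next
    case (5 c)
    show ?case using bij_betwE[OF h] prod.reindex_bij_betw[OF h, of "\<lambda>v. x (c v)"] by simp
  qed
  then show ?thesis by (simp add: colour_density_def)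
qed


section \<open>Sampling from a complete partite graphon\<close>

lemma sum_list_take_mono:
  assumes "\<forall>t\<in>set x. t > (0 :: real)" "i \<le> j"
  shows "sum_list (take i x) \<le> sum_list (take j x)"
proof -
  have "take j x = take i x @ take (j - i) (drop i x)" using take_add[of i "j - i" x] assms(2) by simp
  moreover have "sum_list (take (j - i) (drop i x)) \<ge> 0"
    using assms(1) by (intro sum_list_nonneg) (auto dest!: in_set_takeD in_set_dropD intro: less_imp_le)
  ultimately show ?thesis by simp
qed

text \<open>
  The intervals are half-open except for the last one, so neighbours do not share an end point.
\<close>

lemma part_interval_disjoint:
  assumes "part_sizes x" "i < length x" "j < length x" "s \<in> part_interval x i" "s \<in> part_interval x j"
  shows "i = j"
proof -
  have lt: False if "i < j" "j < length x" "s \<in> part_interval x i" "s \<in> part_interval x j" for i j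
  proof -
    have "s < sum_list (take (Suc i) x)" "sum_list (take j x) \<le> s"
      using that by (auto simp: part_interval_def split: if_splits)
    then show False
      using sum_list_take_mono[of x "Suc i" j] assms(1) that(1) by (auto simp: part_sizes_def)
  qed
  show ?thesis using lt[of i j] lt[of j i] assms by (cases i j rule: linorder_cases) auto
qed

lemma part_interval_sets [measurable]: "part_interval x i \<in> sets borel"
  by (simp add: part_interval_def)

lemma measure_part_interval:
  assumes x: "part_sizes x" and i: "i < length x"
  shows "measure (uniform_measure lborel {0..1}) (part_interval x i) = x ! i"
proof -
  have pos: "\<forall>t\<in>set x. t > 0" and sum: "sum_list x = 1" using x by (auto simp: part_sizes_def)
  have S: "sum_list (take (Suc i) x) = sum_list (take i x) + x ! i"
    using i by (simp add: take_Suc_conv_app_nth)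
  have "0 \<le> sum_list (take i x)" using sum_list_take_mono[OF pos, of 0 i] by simp
  moreover have "sum_list (take (Suc i) x) \<le> 1"
    using sum_list_take_mono[OF pos, of "Suc i" "length x"] i sum by simp
  ultimately have sub: "part_interval x i \<subseteq> {0..1}" by (auto simp: part_interval_def)
  have "x ! i \<ge> 0" using pos i by (auto intro: less_imp_le)
  moreover have "sum_list x = sum_list (take i x) + x ! i" if "Suc i = length x" using S that by simp
  ultimately have "measure lborel (part_interval x i) = x ! i" by (simp add: part_interval_def S)
  moreover have "measure (uniform_measure lborel {0..1}) (part_interval x i)
      = measure lborel ({0..1} \<inter> part_interval x i) / measure lborel {0..1::real}"
    by (intro measure_uniform_measure) auto
  ultimately show ?thesis using sub by (simp add: Int_absorb1)
qed

text \<open>A point outside \<open>{0..1}\<close> gets the extra colour \<open>length x\<close>.\<close>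

definition part_cell :: "real list \<Rightarrow> nat \<Rightarrow> real set" where
  "part_cell x i = (if i < length x then part_interval x i else - (\<Union>j<length x. part_interval x j))"

lemma part_cell_sets [measurable]: "part_cell x i \<in> sets borel"
proof -
  have "(\<Union>j<length x. part_interval x j) \<in> sets borel" by (intro sets.finite_UN) auto
  then show ?thesis unfolding part_cell_def by (simp only: borel_comp part_interval_sets split: if_split) simp
qed

lemma part_cell_exists: "\<exists>i\<le>length x. s \<in> part_cell x i"
  by (cases "\<exists>i<length x. s \<in> part_interval x i") (auto simp: part_cell_def intro: less_imp_le)

lemma part_cell_disjoint:
  assumes "part_sizes x" "i \<le> length x" "j \<le> length x" "s \<in> part_cell x i" "s \<in> part_cell x j"
  shows "i = j"
  using assms part_interval_disjoint[OF assms(1), of i j s]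
  by (auto simp: part_cell_def split: if_splits)

lemma measure_part_cell:
  assumes x: "part_sizes x" and i: "i \<le> length x"
  shows "measure (uniform_measure lborel {0..1}) (part_cell x i) = (if i < length x then x ! i else 0)"
proof (cases "i < length x")
  case True
  then show ?thesis using measure_part_interval[OF x] by (simp add: part_cell_def)
next
  case False
  let ?U = "uniform_measure lborel {0..1::real}"
  interpret U: prob_space ?U by (rule prob_space_uniform_measure) auto
  have "measure ?U (\<Union>j<length x. part_interval x j) = (\<Sum>j<length x. measure ?U (part_interval x j))"
    by (intro U.finite_measure_finite_Union)
       (auto simp: disjoint_family_on_def dest: part_interval_disjoint[OF x])
  also have "\<dots> = sum_list x"
    using measure_part_interval[OF x] by (simp add: sum_list_sum_nth atLeast0LessThan)
  also have "\<dots> = 1" using x by (simp add: part_sizes_def)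
  finally have "measure ?U (space ?U - (\<Union>j<length x. part_interval x j)) = 0"
    by (subst U.prob_compl) auto
  then show ?thesis using False by (simp add: part_cell_def Compl_eq_Diff_UNIV)
qed

lemma sample_graph_partite_graphon:
  assumes x: "part_sizes x" and c: "\<And>v. v < m \<Longrightarrow> c v \<le> length x \<and> \<omega> v \<in> part_cell x (c v)"
  shows "sample_graph (partite_graphon x) m \<omega> =
    ({..<m}, {{u, v} | u v. u < m \<and> v < m \<and> c u \<noteq> c v \<and> c u < length x \<and> c v < length x})"
proof -
  have "partite_graphon x (\<omega> u) (\<omega> v) = 1 \<longleftrightarrow> c u \<noteq> c v \<and> c u < length x \<and> c v < length x"
    if "u < m" "v < m" for u v
  proof -
    have in_cell: "i = c w" if "i < length x" "\<omega> w \<in> part_interval x i" "w < m" for i w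
      using part_cell_disjoint[OF x, of i "c w" "\<omega> w"] c[OF that(3)] that by (auto simp: part_cell_def)
    have "\<omega> w \<in> part_interval x (c w)" if "c w < length x" "w < m" for w
      using c[OF that(2)] that by (auto simp: part_cell_def)
    then have "(\<exists>i<length x. \<exists>j<length x. i \<noteq> j \<and> \<omega> u \<in> part_interval x i \<and> \<omega> v \<in> part_interval x j)
        \<longleftrightarrow> c u \<noteq> c v \<and> c u < length x \<and> c v < length x"
      using in_cell[OF _ _ that(1)] in_cell[OF _ _ that(2)] that by blast
    then show ?thesis unfolding partite_graphon_def by simp
  qed
  then have "u < m \<and> v < m \<and> u \<noteq> v \<and> partite_graphon x (\<omega> u) (\<omega> v) = 1 \<longleftrightarrow>
      u < m \<and> v < m \<and> c u \<noteq> c v \<and> c u < length x \<and> c v < length x" for u v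
    by auto
  then show ?thesis unfolding sample_graph_def by presburger
qed

text \<open>
  The sampled graph depends only on the cells of the points, so the event is a disjoint union of boxes.
  Boxes that use the cell outside of \<open>{0..1}\<close> have measure 0, and the others are the colourings by the
  parts of the graphon.
\<close>

lemma graphon_density_eq_colour_density:
  assumes x: "part_sizes x"
  shows "graphon_density F (partite_graphon x) =
    colour_density F {..<card (verts F)} {..<length x} (\<lambda>i. x ! i)"
proof -
  let ?m = "card (verts F)" and ?l = "length x"
  let ?U = "uniform_measure lborel {0..1::real}"
  let ?P = "uniform_points ?m"
  interpret U: prob_space ?U by (rule prob_space_uniform_measure) auto
  interpret P: finite_product_prob_space "\<lambda>_::nat. ?U" "{..<?m}" by standard auto
  define H where "H c = ({..<?m}, {{u, v} | u v. u < ?m \<and> v < ?m \<and> c u \<noteq> c v \<and> c u < ?l \<and> c v < ?l})"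
    for c :: "nat \<Rightarrow> nat"
  define box where "box c = PiE {..<?m} (\<lambda>v. part_cell x (c v))" for c
  let ?A = "{\<omega> \<in> space ?P. graph_iso F (sample_graph (partite_graphon x) ?m \<omega>)}"
  let ?D = "{c \<in> {..<?m} \<rightarrow>\<^sub>E {..?l}. graph_iso F (H c)}"
  let ?D' = "{c \<in> {..<?m} \<rightarrow>\<^sub>E {..<?l}. graph_iso F (colour_graph {..<?m} c)}"
  let ?p = "\<lambda>i. if i < ?l then x ! i else 0"
  have finD: "finite ?D"
    by (rule finite_subset[of _ "{..<?m} \<rightarrow>\<^sub>E {..?l}"]) (auto intro: finite_PiE)
  have sample: "sample_graph (partite_graphon x) ?m \<omega> = H c"
    if "c \<in> {..<?m} \<rightarrow>\<^sub>E {..?l}" "\<omega> \<in> box c" for c \<omega>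
    unfolding H_def using that by (intro sample_graph_partite_graphon[OF x]) (auto simp: box_def PiE_iff)
  have "?A = (\<Union>c\<in>?D. box c)"
  proof (intro equalityI subsetI)
    fix \<omega> assume \<omega>: "\<omega> \<in> ?A"
    define c where "c v = (SOME i. i \<le> ?l \<and> \<omega> v \<in> part_cell x i)" for v
    have c: "c v \<le> ?l \<and> \<omega> v \<in> part_cell x (c v)" for v
      unfolding c_def by (rule someI_ex[OF part_cell_exists])
    have col: "restrict c {..<?m} \<in> {..<?m} \<rightarrow>\<^sub>E {..?l}" using c by auto
    have inbox: "\<omega> \<in> box (restrict c {..<?m})"
      using \<omega> c by (auto simp: box_def uniform_points_def space_PiM PiE_iff)
    have "graph_iso F (sample_graph (partite_graphon x) ?m \<omega>)" using \<omega> by blast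
    then have "graph_iso F (H (restrict c {..<?m}))" unfolding sample[OF col inbox] .
    then show "\<omega> \<in> (\<Union>c\<in>?D. box c)" using col inbox by blast
  next
    fix \<omega> assume "\<omega> \<in> (\<Union>c\<in>?D. box c)"
    then obtain c where c: "c \<in> ?D" "\<omega> \<in> box c" by blast
    then have "\<omega> \<in> space ?P" by (auto simp: box_def uniform_points_def space_PiM PiE_iff)
    then show "\<omega> \<in> ?A" using c sample[of c \<omega>] by auto
  qed
  moreover have "measure ?P (\<Union>c\<in>?D. box c) = (\<Sum>c\<in>?D. measure ?P (box c))"
    unfolding uniform_points_def
  proof (rule P.finite_measure_finite_Union[OF finD])
    show "box ` ?D \<subseteq> sets (PiM {..<?m} (\<lambda>_. ?U))"
    proof
      fix B assume "B \<in> box ` ?D"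
      then obtain c where "B = box c" by blast
      then show "B \<in> sets (PiM {..<?m} (\<lambda>_. ?U))"
        unfolding box_def by (simp only:) (intro sets_PiM_I_finite; simp)
    qed
    show "disjoint_family_on box ?D"
      unfolding disjoint_family_on_def
    proof (intro ballI impI equals0I)
      fix c d \<omega> assume cd: "c \<in> ?D" "d \<in> ?D" "c \<noteq> d" and \<omega>: "\<omega> \<in> box c \<inter> box d"
      have "c v = d v" if "v < ?m" for v
        using that \<omega> cd by (intro part_cell_disjoint[OF x, of _ _ "\<omega> v"]) (auto simp: box_def PiE_iff)
      then have "c = d"
        using cd by (intro PiE_ext[where k = "{..<?m}" and s = "\<lambda>_. {..?l}"]) auto
      then show False using cd by simp
    qed
  qed
  moreover have "measure ?P (box c) = (\<Prod>v<?m. ?p (c v))" if "c \<in> ?D" for c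
  proof -
    have "measure ?P (box c) = (\<Prod>v<?m. measure ?U (part_cell x (c v)))"
      unfolding uniform_points_def box_def by (rule P.prob_times) simp
    also have "\<dots> = (\<Prod>v<?m. ?p (c v))"
      using that by (intro prod.cong refl measure_part_cell[OF x]) (auto simp: PiE_iff)
    finally show ?thesis .
  qed
  ultimately have "graphon_density F (partite_graphon x) = (\<Sum>c\<in>?D. \<Prod>v<?m. ?p (c v))"
    by (simp add: graphon_density_def)
  also have "\<dots> = (\<Sum>c\<in>?D'. \<Prod>v<?m. ?p (c v))"
  proof (rule sum.mono_neutral_right[OF finD])
    have eq: "H c = colour_graph {..<?m} c" if "c \<in> {..<?m} \<rightarrow>\<^sub>E {..<?l}" for c
    proof -
      have "c u < ?l" if "u < ?m" for u using \<open>c \<in> _\<close> that by auto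
      then show ?thesis unfolding H_def colour_graph_def by auto
    qed
    have sub: "c \<in> {..<?m} \<rightarrow>\<^sub>E {..?l}" if "c \<in> {..<?m} \<rightarrow>\<^sub>E {..<?l}" for c
      using that by (auto simp: PiE_iff intro: less_imp_le)
    show "?D' \<subseteq> ?D" using eq sub by auto
    show "\<forall>c\<in>?D - ?D'. (\<Prod>v<?m. ?p (c v)) = 0"
    proof
      fix c assume c: "c \<in> ?D - ?D'"
      then have "c \<notin> {..<?m} \<rightarrow>\<^sub>E {..<?l}" using eq by auto
      then obtain v where "v < ?m" "\<not> c v < ?l" using c by (auto simp: PiE_iff)
      then show "(\<Prod>v<?m. ?p (c v)) = 0" by (intro prod_zero) auto
    qed
  qed
  also have "\<dots> = (\<Sum>c\<in>?D'. \<Prod>v<?m. x ! c v)"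
    by (intro sum.cong prod.cong refl) (auto simp: PiE_iff)
  finally show ?thesis by (simp add: colour_density_def)
qed


section \<open>Symmetrization\<close>

text \<open>
  In \<open>clone u v G\<close> the vertex \<open>u\<close> becomes a clone of \<open>v\<close>: every pair is adjacent iff its image under
  the map that sends \<open>u\<close> to \<open>v\<close> is adjacent in \<open>G\<close>.
\<close>

definition clone :: "'a \<Rightarrow> 'a \<Rightarrow> 'a graph \<Rightarrow> 'a graph" where
  "clone u v G = (verts G, {{p, q} | p q. p \<in> verts G \<and> q \<in> verts G \<and>
                               {(id(u := v)) p, (id(u := v)) q} \<in> edges G})"

lemma verts_clone [simp]: "verts (clone u v G) = verts G"
  by (simp add: clone_def)

lemma edge_clone:
  "{p, q} \<in> edges (clone u v G) \<longleftrightarrow> p \<in> verts G \<and> q \<in> verts G \<and>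
     {(id(u := v)) p, (id(u := v)) q} \<in> edges G"
  unfolding clone_def by (auto simp: doubleton_eq_iff insert_commute)

lemma simple_graph_edgeD:
  assumes "simple_graph G" "{p, q} \<in> edges G"
  shows "p \<in> verts G" "q \<in> verts G" "p \<noteq> q"
proof -
  have "{p, q} \<in> nsets (verts G) 2" using assms unfolding simple_graph_def by blast
  then have "{p, q} \<subseteq> verts G" "card {p, q} = 2" by (auto simp: nsets_def)
  then show "p \<in> verts G" "q \<in> verts G" "p \<noteq> q" by auto
qed

lemma simple_graph_clone: "simple_graph G \<Longrightarrow> simple_graph (clone u v G)"
proof -
  assume G: "simple_graph G"
  have "e \<in> nsets (verts G) 2" if edge: "e \<in> edges (clone u v G)" for e
  proof -
    obtain p q where e: "e = {p, q}" "p \<in> verts G" "q \<in> verts G"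
      and "{(id(u := v)) p, (id(u := v)) q} \<in> edges G"
      using edge unfolding clone_def snd_conv by blast
    then have "p \<noteq> q" using simple_graph_edgeD(3)[OF G] by blast
    then show ?thesis using e by (simp add: nsets_def)
  qed
  then show ?thesis using G by (auto simp: simple_graph_def)
qed

text \<open>
  A clique of the new graph does not contain both \<open>u\<close> and \<open>v\<close>, so sending \<open>u\<close> to \<open>v\<close> is injective on it
  and maps it to a clique of \<open>G\<close>.
\<close>

lemma contains_K_clone:
  assumes "simple_graph G" "u \<in> verts G" "v \<in> verts G" "{u, v} \<notin> edges G"
    and "contains_K k (clone u v G)"
  shows "contains_K k G"
proof -
  let ?\<rho> = "id(u := v)"
  obtain S where S: "S \<subseteq> verts G" "card S = k"
    and K: "\<And>p q. p \<in> S \<Longrightarrow> q \<in> S \<Longrightarrow> p \<noteq> q \<Longrightarrow> {?\<rho> p, ?\<rho> q} \<in> edges G"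
    using assms(5) by (auto simp: contains_K_def clique_def edge_clone)
  have inj: "inj_on ?\<rho> S"
    using K simple_graph_edgeD(3)[OF assms(1)] by (meson inj_onI)
  have "clique (?\<rho> ` S) (edges G)" using K unfolding clique_def by blast
  moreover have "?\<rho> ` S \<subseteq> verts G" using S assms(3) by auto
  ultimately show ?thesis
    using card_image[OF inj] S by (metis contains_K_def)
qed

lemma graph_iso_induced_subgraph:
  assumes "bij_betw h S S'"
    and "\<And>p q. p \<in> S \<Longrightarrow> q \<in> S \<Longrightarrow> {p, q} \<in> edges G \<longleftrightarrow> {h p, h q} \<in> edges G'"
  shows "graph_iso (induced_subgraph G S) (induced_subgraph G' S')"
proof (rule graph_isoI[of h])
  show "bij_betw h (verts (induced_subgraph G S)) (verts (induced_subgraph G' S'))"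
    using assms(1) by (simp add: induced_subgraph_def)
qed (use assms(2) bij_betwE[OF assms(1)] in \<open>simp add: induced_subgraph_def\<close>)

definition copies :: "'a graph \<Rightarrow> 'b graph \<Rightarrow> 'b set set" where
  "copies F G = {S. S \<subseteq> verts G \<and> card S = card (verts F) \<and> graph_iso F (induced_subgraph G S)}"

lemma induced_count_eq: "induced_count F G = card (copies F G)"
  by (simp add: induced_count_def copies_def)

lemma finite_copies: "finite (verts G) \<Longrightarrow> finite (copies F G)"
  by (rule finite_subset[of _ "Pow (verts G)"]) (auto simp: copies_def)

lemma copies_cong:
  assumes "S \<subseteq> verts G" "verts G = verts G'" and
    "\<And>p q. p \<in> S \<Longrightarrow> q \<in> S \<Longrightarrow> {p, q} \<in> edges G \<longleftrightarrow> {p, q} \<in> edges G'"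
  shows "S \<in> copies F G \<longleftrightarrow> S \<in> copies F G'"
  using assms graph_iso_cong[OF graph_iso_induced_subgraph[of id S S G G'], of F]
  by (simp add: copies_def)

text \<open>
  This is the property of complete partite graphs behind symmetrization: nonadjacency is transitive
  in \<open>F\<close>, hence in every copy of \<open>F\<close>.
\<close>

lemma nonadjacent_in_copy_twins:
  assumes S: "S \<in> copies (complete_partite a) G" and "u \<in> S" "v \<in> S" "{u, v} \<notin> edges G" "p \<in> S"
  shows "{u, p} \<in> edges G \<longleftrightarrow> {v, p} \<in> edges G"
proof -
  let ?F = "complete_partite a"
  obtain g where g: "bij_betw g S (verts ?F)"
    and e: "\<And>p q. p \<in> S \<Longrightarrow> q \<in> S \<Longrightarrow> {p, q} \<in> edges G \<longleftrightarrow> {g p, g q} \<in> edges ?F"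
    using S graph_iso_sym[of ?F "induced_subgraph G S"]
    by (auto simp: copies_def graph_iso_def induced_subgraph_def)
  have "{p, q} \<in> edges G \<longleftrightarrow> fst (g p) \<noteq> fst (g q)" if "p \<in> S" "q \<in> S" for p q
    using e that bij_betwE[OF g] by (auto simp: edge_complete_partite)
  then show ?thesis using assms(2-) by metis
qed

text \<open>
  Copies avoiding \<open>u\<close> survive the cloning, and those of them that contain \<open>v\<close> give a second copy with
  \<open>u\<close> in place of \<open>v\<close>. Copies containing both vertices survive because \<open>u\<close> and \<open>v\<close> already had the same
  neighbours inside of the copy. Copies with \<open>u\<close> but without \<open>v\<close> may be lost.
\<close>

lemma induced_count_clone_ge:
  assumes G: "simple_graph G" and uv: "u \<in> verts G" "v \<in> verts G" "u \<noteq> v" "{u, v} \<notin> edges G"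
  shows "card {S \<in> copies (complete_partite a) G. u \<notin> S \<and> v \<notin> S}
       + 2 * card {S \<in> copies (complete_partite a) G. u \<notin> S \<and> v \<in> S}
       + card {S \<in> copies (complete_partite a) G. u \<in> S \<and> v \<in> S}
       \<le> induced_count (complete_partite a) (clone u v G)" (is "card ?N0 + 2 * card ?Nv + card ?Nuv \<le> _")
proof -
  let ?F = "complete_partite a"
  let ?swap = "\<lambda>S. insert u (S - {v})"
  have fin: "finite (copies ?F G)" "finite (copies ?F (clone u v G))"
    using G by (auto simp: simple_graph_def intro: finite_copies)
  have "?N0 \<union> ?Nv \<subseteq> copies ?F (clone u v G)"
  proof
    fix S assume S: "S \<in> ?N0 \<union> ?Nv"
    then have sub: "S \<subseteq> verts G" and "u \<notin> S" by (auto simp: copies_def)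
    then have "{p, q} \<in> edges G \<longleftrightarrow> {p, q} \<in> edges (clone u v G)" if "p \<in> S" "q \<in> S" for p q
      using that by (auto simp: edge_clone)
    then show "S \<in> copies ?F (clone u v G)"
      using S copies_cong[OF sub, of "clone u v G" ?F] by auto
  qed
  moreover have "?Nuv \<subseteq> copies ?F (clone u v G)"
  proof
    fix S assume S: "S \<in> ?Nuv"
    then have sub: "S \<subseteq> verts G" and tw: "\<And>p. p \<in> S \<Longrightarrow> {u, p} \<in> edges G \<longleftrightarrow> {v, p} \<in> edges G"
      using nonadjacent_in_copy_twins[of S a G u v] uv by (auto simp: copies_def)
    have nl: "{w} \<notin> edges G" for w using simple_graph_edgeD(3)[OF G, of w w] by auto
    have "{p, q} \<in> edges G \<longleftrightarrow> {p, q} \<in> edges (clone u v G)" if "p \<in> S" "q \<in> S" for p q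
    proof -
      have pq: "p \<in> verts G" "q \<in> verts G" using that sub by auto
      consider "p \<noteq> u" "q \<noteq> u" | "p = u" "q = u" | "p = u" "q \<noteq> u" | "p \<noteq> u" "q = u" by blast
      then have "{p, q} \<in> edges G \<longleftrightarrow> {(id(u := v)) p, (id(u := v)) q} \<in> edges G"
        using tw[OF that(1)] tw[OF that(2)] nl by cases (simp_all add: insert_commute)
      then show ?thesis using pq by (simp only: edge_clone simp_thms)
    qed
    then show "S \<in> copies ?F (clone u v G)"
      using S copies_cong[OF sub, of "clone u v G" ?F] by auto
  qed
  moreover have "?swap ` ?Nv \<subseteq> copies ?F (clone u v G)"
  proof
    fix T assume "T \<in> ?swap ` ?Nv"
    then obtain S where S: "S \<in> copies ?F G" "u \<notin> S" "v \<in> S" and T: "T = ?swap S" by auto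
    have sub: "S \<subseteq> verts G" and card: "card S = card (verts ?F)"
      and iso: "graph_iso ?F (induced_subgraph G S)" using S by (auto simp: copies_def)
    have finS: "finite S" using sub G by (auto simp: simple_graph_def intro: finite_subset)
    have bij: "bij_betw (id(u := v)) T S"
      unfolding T bij_betw_def using S by (auto simp: inj_on_def)
    have "graph_iso (induced_subgraph (clone u v G) T) (induced_subgraph G S)"
      using sub uv T by (intro graph_iso_induced_subgraph[OF bij]) (auto simp: edge_clone)
    then have "graph_iso ?F (induced_subgraph (clone u v G) T)"
      using iso graph_iso_cong by blast
    moreover have "card T = card S" using bij by (rule bij_betw_same_card)
    ultimately show "T \<in> copies ?F (clone u v G)"
      using card sub uv T by (auto simp: copies_def)
  qed
  ultimately have "?N0 \<union> ?Nv \<union> ?Nuv \<union> ?swap ` ?Nv \<subseteq> copies ?F (clone u v G)" by blast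
  then have "card (?N0 \<union> ?Nv \<union> ?Nuv \<union> ?swap ` ?Nv) \<le> induced_count ?F (clone u v G)"
    unfolding induced_count_eq by (rule card_mono[OF fin(2)])
  also have "card (?N0 \<union> ?Nv \<union> ?Nuv \<union> ?swap ` ?Nv) =
             card (?N0 \<union> ?Nv \<union> ?Nuv) + card (?swap ` ?Nv)"
    using fin uv by (intro card_Un_disjoint) auto
  also have "card (?N0 \<union> ?Nv \<union> ?Nuv) = card (?N0 \<union> ?Nv) + card ?Nuv"
    using fin by (intro card_Un_disjoint) auto
  also have "card (?N0 \<union> ?Nv) = card ?N0 + card ?Nv"
    using fin by (intro card_Un_disjoint) auto
  also have "card (?swap ` ?Nv) = card ?Nv"
  proof (rule card_image, rule inj_onI)
    fix S T assume *: "S \<in> ?Nv" "T \<in> ?Nv" "?swap S = ?swap T"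
    then have "insert v (?swap S - {u}) = insert v (?swap T - {u})" by simp
    moreover have "insert v (?swap S - {u}) = S" "insert v (?swap T - {u}) = T"
      using * uv by auto
    ultimately show "S = T" by simp
  qed
  finally show ?thesis by simp
qed

text \<open>
  Adding the bounds for the two directions, the gains from one direction make up for the losses of the
  other one.
\<close>

lemma induced_count_clone_average:
  assumes G: "simple_graph G" and uv: "u \<in> verts G" "v \<in> verts G" "u \<noteq> v" "{u, v} \<notin> edges G"
  shows "2 * induced_count (complete_partite a) G
       \<le> induced_count (complete_partite a) (clone u v G) + induced_count (complete_partite a) (clone v u G)"
proof -
  let ?F = "complete_partite a"
  let ?C = "copies ?F G"
  let ?N0 = "{S \<in> ?C. u \<notin> S \<and> v \<notin> S}" and ?Nu = "{S \<in> ?C. v \<notin> S \<and> u \<in> S}"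
    and ?Nv = "{S \<in> ?C. u \<notin> S \<and> v \<in> S}" and ?Nuv = "{S \<in> ?C. u \<in> S \<and> v \<in> S}"
  have fin: "finite ?C" using G by (auto simp: simple_graph_def intro: finite_copies)
  have "?C = (?N0 \<union> ?Nu) \<union> (?Nv \<union> ?Nuv)" by auto
  then have "card ?C = card ((?N0 \<union> ?Nu) \<union> (?Nv \<union> ?Nuv))" by (rule arg_cong)
  also have "\<dots> \<le> card (?N0 \<union> ?Nu) + card (?Nv \<union> ?Nuv)" by (rule card_Un_le)
  also have "\<dots> \<le> card ?N0 + card ?Nu + (card ?Nv + card ?Nuv)"
    by (intro add_mono card_Un_le)
  finally have "induced_count ?F G \<le> card ?N0 + card ?Nu + card ?Nv + card ?Nuv"
    by (simp add: induced_count_eq)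
  moreover have "card ?N0 + 2 * card ?Nv + card ?Nuv \<le> induced_count ?F (clone u v G)"
    using induced_count_clone_ge[OF G uv] .
  moreover have "card ?N0 + 2 * card ?Nu + card ?Nuv \<le> induced_count ?F (clone v u G)"
    using induced_count_clone_ge[OF G uv(2,1), of a] uv by (simp add: insert_commute conj_commute)
  ultimately show ?thesis by linarith
qed

definition twins :: "'a graph \<Rightarrow> 'a \<Rightarrow> 'a \<Rightarrow> bool" where
  "twins G p q \<longleftrightarrow> (\<forall>w\<in>verts G. {p, w} \<in> edges G \<longleftrightarrow> {q, w} \<in> edges G)"

definition twin_class :: "'a graph \<Rightarrow> 'a \<Rightarrow> 'a set" where
  "twin_class G p = {q \<in> verts G. twins G p q}"

definition twin_pairs :: "'a graph \<Rightarrow> ('a \<times> 'a) set" where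
  "twin_pairs G = {(p, q). p \<in> verts G \<and> q \<in> verts G \<and> twins G p q}"

lemma finite_twin_pairs: "finite (verts G) \<Longrightarrow> finite (twin_pairs G)"
  by (rule finite_subset[of _ "verts G \<times> verts G"]) (auto simp: twin_pairs_def)

text \<open>
  The only twins that are lost are those of \<open>u\<close>, which moves from its own twin class to the class of
  \<open>v\<close>. If the latter is not smaller, the number of pairs of twins grows.
\<close>

lemma twin_pairs_clone:
  assumes G: "simple_graph G" and uv: "u \<in> verts G" "v \<in> verts G" "{u, v} \<notin> edges G"
    and nt: "\<not> twins G u v" and le: "card (twin_class G u) \<le> card (twin_class G v)"
  shows "card (twin_pairs G) < card (twin_pairs (clone u v G))"
proof -
  let ?T = "twin_pairs G" and ?U = "twin_class G u" and ?W = "twin_class G v"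
  let ?K = "{(p, q) \<in> ?T. p \<noteq> u \<and> q \<noteq> u}"
  have finV: "finite (verts G)" using G by (simp add: simple_graph_def)
  have finT: "finite ?T" by (rule finite_twin_pairs[OF finV])
  have fin: "finite ?U" "finite ?W" "finite ?K" "finite (twin_pairs (clone u v G))"
    using finV finT by (auto simp: twin_class_def intro: finite_twin_pairs finite_subset[OF _ finT])
  have uU: "u \<in> ?U" and uW: "u \<notin> ?W"
    using uv nt by (auto simp: twin_class_def twins_def)
  have sym: "twins G p q \<longleftrightarrow> twins G q p" for p q by (auto simp: twins_def)
  have "?T \<subseteq> ?K \<union> ({u} \<times> ?U \<union> (?U - {u}) \<times> {u})"
    using sym by (auto simp: twin_pairs_def twin_class_def)
  then have "card ?T \<le> card (?K \<union> ({u} \<times> ?U \<union> (?U - {u}) \<times> {u}))"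
    using fin by (intro card_mono) auto
  also have "\<dots> \<le> card ?K + (card ({u} \<times> ?U) + card ((?U - {u}) \<times> {u}))"
    by (meson add_left_mono card_Un_le le_trans)
  also have "\<dots> = card ?K + card ?U + (card ?U - 1)"
    using uU fin by (simp add: card_cartesian_product)
  finally have 1: "card ?T \<le> card ?K + card ?U + (card ?U - 1)" .
  have vW: "?W \<noteq> {}" "card ?U > 0" using uv uU fin by (auto simp: twin_class_def twins_def card_gt_0_iff)
  have "?K \<union> ({u} \<times> ?W \<union> ?W \<times> {u}) \<subseteq> twin_pairs (clone u v G)"
  proof -
    have old: "twins (clone u v G) p q" if "twins G p q" "p \<in> verts G" "q \<in> verts G" "p \<noteq> u" "q \<noteq> u" for p q
      unfolding twins_def
    proof
      fix w assume w: "w \<in> verts (clone u v G)"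
      then have "(id(u := v)) w \<in> verts G" using uv by simp
      then have "{p, (id(u := v)) w} \<in> edges G \<longleftrightarrow> {q, (id(u := v)) w} \<in> edges G"
        using that(1) unfolding twins_def by blast
      then show "{p, w} \<in> edges (clone u v G) \<longleftrightarrow> {q, w} \<in> edges (clone u v G)"
        using w that by (simp add: edge_clone)
    qed
    have new: "twins (clone u v G) u q" "twins (clone u v G) q u" if "q \<in> ?W" for q
    proof -
      have q: "q \<in> verts G" "q \<noteq> u" "twins G v q" using that uW by (auto simp: twin_class_def)
      show "twins (clone u v G) u q"
        unfolding twins_def
      proof
        fix w assume w: "w \<in> verts (clone u v G)"
        then have "(id(u := v)) w \<in> verts G" using uv by simp
        then have "{v, (id(u := v)) w} \<in> edges G \<longleftrightarrow> {q, (id(u := v)) w} \<in> edges G"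
          using q(3) unfolding twins_def by blast
        then show "{u, w} \<in> edges (clone u v G) \<longleftrightarrow> {q, w} \<in> edges (clone u v G)"
          using w q uv by (simp add: edge_clone)
      qed
      then show "twins (clone u v G) q u" by (simp add: twins_def)
    qed
    have W: "?W \<subseteq> verts G" by (auto simp: twin_class_def)
    show ?thesis
    proof
      fix z assume z: "z \<in> ?K \<union> ({u} \<times> ?W \<union> ?W \<times> {u})"
      obtain p q where "z = (p, q)" by (cases z)
      with z show "z \<in> twin_pairs (clone u v G)"
        using old[of p q] new W uv(1) by (auto simp: twin_pairs_def)
    qed
  qed
  then have "card (?K \<union> ({u} \<times> ?W \<union> ?W \<times> {u})) \<le> card (twin_pairs (clone u v G))"
    using fin by (intro card_mono) auto
  moreover have "card (?K \<union> ({u} \<times> ?W \<union> ?W \<times> {u})) = card ?K + card ({u} \<times> ?W \<union> ?W \<times> {u})"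
    using fin by (intro card_Un_disjoint) auto
  moreover have "card ({u} \<times> ?W \<union> ?W \<times> {u}) = card ({u} \<times> ?W) + card (?W \<times> {u})"
    using fin uW by (intro card_Un_disjoint) auto
  moreover have "card ({u} \<times> ?W) = card ?W" "card (?W \<times> {u}) = card ?W"
    by (simp_all add: card_cartesian_product)
  ultimately show ?thesis using 1 le vW by linarith
qed

lemma finite_obtains_maximizer:
  fixes f :: "'a \<Rightarrow> nat"
  assumes "finite A" "A \<noteq> {}"
  obtains x where "x \<in> A" "\<And>y. y \<in> A \<Longrightarrow> f y \<le> f x"
proof -
  have "Max (f ` A) \<in> f ` A" using assms by (intro Max_in) auto
  then obtain x where "x \<in> A" "f x = Max (f ` A)" by auto
  then show ?thesis using assms by (intro that[of x]) auto
qed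

text \<open>
  Both clonings of a maximizer are maximizers again, since their average is not smaller. So a maximizer
  with the largest number of pairs of twins has no nonadjacent pair \<open>u\<close>, \<open>v\<close> of non-twins: cloning the
  vertex with the larger twin class would yield a maximizer with more pairs of twins.
\<close>

lemma exists_symmetrized_maximizer:
  fixes f :: "'a graph \<Rightarrow> nat"
  assumes fin: "finite \<G>" "\<G> \<noteq> {}" and simple: "\<And>G. G \<in> \<G> \<Longrightarrow> simple_graph G"
    and closed: "\<And>G u v. \<lbrakk>G \<in> \<G>; u \<in> verts G; v \<in> verts G; {u, v} \<notin> edges G\<rbrakk> \<Longrightarrow> clone u v G \<in> \<G>"
    and average: "\<And>G u v. \<lbrakk>G \<in> \<G>; u \<in> verts G; v \<in> verts G; u \<noteq> v; {u, v} \<notin> edges G\<rbrakk> \<Longrightarrow>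
                    2 * f G \<le> f (clone u v G) + f (clone v u G)"
  obtains G where "G \<in> \<G>" "\<And>H. H \<in> \<G> \<Longrightarrow> f H \<le> f G"
    "\<And>u v. u \<in> verts G \<Longrightarrow> v \<in> verts G \<Longrightarrow> {u, v} \<notin> edges G \<Longrightarrow> twins G u v"
proof -
  define \<M> where "\<M> = {G \<in> \<G>. \<forall>H\<in>\<G>. f H \<le> f G}"
  have "\<M> \<noteq> {}"
    unfolding \<M>_def by (rule finite_obtains_maximizer[OF fin, of f]) blast
  moreover have "finite \<M>" using fin by (simp add: \<M>_def)
  ultimately obtain G where G: "G \<in> \<M>"
    and max: "\<And>H. H \<in> \<M> \<Longrightarrow> card (twin_pairs H) \<le> card (twin_pairs G)"
    using finite_obtains_maximizer[of \<M> "\<lambda>G. card (twin_pairs G)"] by blast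
  have GG: "G \<in> \<G>" and opt: "\<And>H. H \<in> \<G> \<Longrightarrow> f H \<le> f G" using G by (auto simp: \<M>_def)
  have "twins G u v" if uv: "u \<in> verts G" "v \<in> verts G" "{u, v} \<notin> edges G" for u v
  proof (rule ccontr)
    assume nt: "\<not> twins G u v"
    have vu: "{v, u} \<notin> edges G" "\<not> twins G v u" using uv nt by (auto simp: insert_commute twins_def)
    have "u \<noteq> v" using nt by (auto simp: twins_def)
    have cl: "clone u v G \<in> \<G>" "clone v u G \<in> \<G>" using closed GG uv vu by auto
    have "f (clone u v G) = f G" "f (clone v u G) = f G"
      using average[OF GG uv(1,2) \<open>u \<noteq> v\<close> uv(3)] opt[OF cl(1)] opt[OF cl(2)] by auto
    then have "clone u v G \<in> \<M>" "clone v u G \<in> \<M>" using cl opt by (auto simp: \<M>_def)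
    then have "card (twin_pairs (clone u v G)) \<le> card (twin_pairs G)"
      "card (twin_pairs (clone v u G)) \<le> card (twin_pairs G)" using max by auto
    then show False
      using twin_pairs_clone[OF simple[OF GG] uv nt]
        twin_pairs_clone[OF simple[OF GG] uv(2,1) vu] by linarith
  qed
  then show ?thesis using that GG opt by blast
qed

text \<open>
  If nonadjacent vertices are twins, nonadjacency is an equivalence relation. Each class is coloured by
  its smallest element, and the representatives form a clique.
\<close>

lemma nonadjacent_twins_imp_colour_graph:
  fixes G :: "nat graph"
  assumes G: "simple_graph G"
    and tw: "\<And>u v. u \<in> verts G \<Longrightarrow> v \<in> verts G \<Longrightarrow> {u, v} \<notin> edges G \<Longrightarrow> twins G u v"
    and k: "\<not> contains_K k G"
  obtains c where "G = colour_graph (verts G) c" "card (c ` verts G) < k"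
proof -
  define nb where "nb v = {w \<in> verts G. {v, w} \<notin> edges G}" for v
  define c where "c v = Min (nb v)" for v
  have finV: "finite (verts G)" using G by (simp add: simple_graph_def)
  have nl: "{w} \<notin> edges G" for w using simple_graph_edgeD(3)[OF G, of w w] by auto
  have c: "c v \<in> verts G" "{v, c v} \<notin> edges G" if "v \<in> verts G" for v
  proof -
    have "c v \<in> nb v"
      unfolding c_def using that finV nl by (intro Min_in) (auto simp: nb_def)
    then show "c v \<in> verts G" "{v, c v} \<notin> edges G" by (auto simp: nb_def)
  qed
  have eq: "c u = c v" if "u \<in> verts G" "v \<in> verts G" "{u, v} \<notin> edges G" for u v
    using tw[OF that] by (auto simp: c_def nb_def twins_def intro!: arg_cong[of _ _ Min])
  have adj: "{u, v} \<in> edges G \<longleftrightarrow> c u \<noteq> c v" if "u \<in> verts G" "v \<in> verts G" for u v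
  proof
    assume e: "{u, v} \<in> edges G"
    show "c u \<noteq> c v"
    proof
      assume "c u = c v"
      then have "twins G u (c v)" using tw[OF that(1)] c[OF that(1)] by auto
      then have "{u, v} \<in> edges G \<longleftrightarrow> {c v, v} \<in> edges G" using that unfolding twins_def by blast
      then show False using e c(2)[OF that(2)] by (simp add: insert_commute)
    qed
  qed (use eq that in blast)
  have "edges G = edges (colour_graph (verts G) c)"
  proof (intro equalityI subsetI)
    fix e assume e: "e \<in> edges G"
    then obtain u v where "e = {u, v}" "u \<in> verts G" "v \<in> verts G"
    proof -
      have "e \<subseteq> verts G" "card e = 2" using G e by (auto simp: simple_graph_def nsets_def)
      then show ?thesis using that by (auto simp: card_2_iff)
    qed
    then show "e \<in> edges (colour_graph (verts G) c)" using adj e by (auto simp: edge_colour_graph)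
  next
    fix e assume "e \<in> edges (colour_graph (verts G) c)"
    then show "e \<in> edges G" using adj by (auto simp: colour_graph_def)
  qed
  then have "G = colour_graph (verts G) c" by (simp add: prod_eq_iff)
  moreover have "card (c ` verts G) < k"
  proof (rule ccontr)
    assume "\<not> card (c ` verts G) < k"
    then obtain S where S: "S \<subseteq> c ` verts G" "card S = k"
      by (meson not_less obtain_subset_with_card_n)
    have fixed: "c w = w" if w: "w \<in> S" for w
    proof -
      obtain v where v: "v \<in> verts G" "w = c v" using S(1) w by blast
      then show ?thesis using eq[OF v(1) c[OF v(1)]] by simp
    qed
    have "S \<subseteq> verts G" using S(1) c(1) by blast
    moreover from this have "clique S (edges G)"
      unfolding clique_def using adj fixed by (metis subsetD)
    ultimately show False using k S(2) unfolding contains_K_def by blast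
  qed
  ultimately show ?thesis by (rule that)
qed


section \<open>Random colourings: the lower bound\<close>

text \<open>
  The marginal of a random colouring of \<open>V\<close> on a subset \<open>S\<close> is a random colouring of \<open>S\<close>: the colour of
  every other vertex sums out to 1.
\<close>

lemma sum_PiE_restrict:
  fixes x :: "nat \<Rightarrow> real" and g :: "('v \<Rightarrow> nat) \<Rightarrow> real"
  assumes "finite V" "S \<subseteq> V" "finite I" "sum x I = 1"
  shows "(\<Sum>c\<in>V \<rightarrow>\<^sub>E I. (\<Prod>v\<in>V. x (c v)) * g (restrict c S)) = (\<Sum>d\<in>S \<rightarrow>\<^sub>E I. (\<Prod>v\<in>S. x (d v)) * g d)"
proof -
  have "(\<Sum>c\<in>(W \<union> S) \<rightarrow>\<^sub>E I. (\<Prod>v\<in>W \<union> S. x (c v)) * g (restrict c S))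
      = (\<Sum>d\<in>S \<rightarrow>\<^sub>E I. (\<Prod>v\<in>S. x (d v)) * g d)"
    if "finite W" "W \<inter> S = {}" "finite S" for W
    using that
  proof (induction W rule: finite_induct)
    case empty
    have "restrict d S = d" if "d \<in> S \<rightarrow>\<^sub>E I" for d using that by (auto simp: PiE_iff extensional_restrict)
    then show ?case by simp
  next
    case (insert w W)
    let ?U = "W \<union> S"
    have w: "w \<notin> ?U" "w \<notin> S" "finite ?U" using insert by auto
    have "(\<Sum>c\<in>insert w ?U \<rightarrow>\<^sub>E I. (\<Prod>v\<in>insert w ?U. x (c v)) * g (restrict c S)) =
       (\<Sum>(q, c)\<in>I \<times> (?U \<rightarrow>\<^sub>E I). (\<Prod>v\<in>insert w ?U. x ((c(w := q)) v)) * g (restrict (c(w := q)) S))"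
      unfolding PiE_insert_eq
      by (subst sum.reindex[OF inj_combinator[OF w(1)]]) (simp add: case_prod_unfold)
    also have "\<dots> = (\<Sum>(q, c)\<in>I \<times> (?U \<rightarrow>\<^sub>E I). x q * ((\<Prod>v\<in>?U. x (c v)) * g (restrict c S)))"
    proof (intro sum.cong refl, clarify)
      fix q and c :: "'v \<Rightarrow> nat"
      have "restrict (c(w := q)) S = restrict c S" using w by (auto intro!: restrict_ext)
      moreover have "(\<Prod>v\<in>?U. x ((c(w := q)) v)) = (\<Prod>v\<in>?U. x (c v))"
        using w by (intro prod.cong) auto
      ultimately show "(\<Prod>v\<in>insert w ?U. x ((c(w := q)) v)) * g (restrict (c(w := q)) S) =
          x q * ((\<Prod>v\<in>?U. x (c v)) * g (restrict c S))"
        using w by simp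
    qed
    also have "\<dots> = sum x I * (\<Sum>c\<in>?U \<rightarrow>\<^sub>E I. (\<Prod>v\<in>?U. x (c v)) * g (restrict c S))"
      by (simp add: sum.cartesian_product[symmetric] sum_distrib_left[symmetric] sum_distrib_right)
    also have "(\<Sum>c\<in>?U \<rightarrow>\<^sub>E I. (\<Prod>v\<in>?U. x (c v)) * g (restrict c S))
        = (\<Sum>d\<in>S \<rightarrow>\<^sub>E I. (\<Prod>v\<in>S. x (d v)) * g d)"
      using insert by (intro insert.IH) auto
    finally show ?case using assms(4) by (simp only: Un_insert_left mult_1)
  qed
  note gen = this
  have "(V - S) \<union> S = V" "(V - S) \<inter> S = {}" using assms(2) by auto
  moreover have "finite (V - S)" "finite S" using assms by (auto intro: finite_subset)
  ultimately show ?thesis using gen[of "V - S"] by (simp only:)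
qed

lemma induced_subgraph_colour_graph:
  "S \<subseteq> V \<Longrightarrow> induced_subgraph (colour_graph V c) S = colour_graph S (restrict c S)"
  unfolding induced_subgraph_def colour_graph_def by fastforce

lemma colour_density_initial_segment:
  assumes "finite S" "card S = m"
  shows "colour_density F S I x = colour_density F {..<m} I x"
proof -
  obtain h where "bij_betw h S {..<m}" using assms finite_same_card_bij[of S "{..<m}"] by auto
  then show ?thesis by (rule colour_density_reindex)
qed

text \<open>
  Linearity of expectation over the vertex sets that can carry a copy of \<open>F\<close>.
\<close>

lemma expected_induced_count:
  assumes V: "finite V" and prof: "profile I x"
  shows "(\<Sum>c\<in>V \<rightarrow>\<^sub>E I. (\<Prod>v\<in>V. x (c v)) * real (induced_count F (colour_graph V c)))
       = real (card V choose card (verts F)) * colour_density F {..<card (verts F)} I x"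
proof -
  let ?m = "card (verts F)"
  let ?S = "{S. S \<subseteq> V \<and> card S = ?m}"
  let ?ind = "\<lambda>S d. if graph_iso F (colour_graph S d) then 1 else (0 :: real)"
  have I: "finite I" "sum x I = 1" using prof by (auto simp: profile_def)
  have finS: "finite ?S" using V by simp
  have "real (induced_count F (colour_graph V c)) = (\<Sum>S\<in>?S. ?ind S (restrict c S))" for c
  proof -
    have "induced_count F (colour_graph V c) = card {S \<in> ?S. graph_iso F (colour_graph S (restrict c S))}"
      unfolding induced_count_def
      by (rule arg_cong[of _ _ card]) (auto simp: induced_subgraph_colour_graph)
    then show ?thesis using finS by (simp add: sum.inter_filter[symmetric])
  qed
  then have "(\<Sum>c\<in>V \<rightarrow>\<^sub>E I. (\<Prod>v\<in>V. x (c v)) * real (induced_count F (colour_graph V c)))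
      = (\<Sum>S\<in>?S. \<Sum>c\<in>V \<rightarrow>\<^sub>E I. (\<Prod>v\<in>V. x (c v)) * ?ind S (restrict c S))"
    by (simp only: sum_distrib_left) (rule sum.swap)
  also have "\<dots> = (\<Sum>S\<in>?S. colour_density F {..<?m} I x)"
  proof (rule sum.cong[OF refl])
    fix S assume S: "S \<in> ?S"
    then have "finite S" using V finite_subset by blast
    have "(\<Sum>c\<in>V \<rightarrow>\<^sub>E I. (\<Prod>v\<in>V. x (c v)) * ?ind S (restrict c S))
        = (\<Sum>d\<in>S \<rightarrow>\<^sub>E I. (\<Prod>v\<in>S. x (d v)) * ?ind S d)"
      using S V I by (intro sum_PiE_restrict) auto
    also have "\<dots> = colour_density F S I x"
      unfolding colour_density_def using \<open>finite S\<close> I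
      by (subst sum.inter_filter) (auto intro!: sum.cong finite_PiE)
    also have "\<dots> = colour_density F {..<?m} I x"
      using S \<open>finite S\<close> by (intro colour_density_initial_segment) auto
    finally show "(\<Sum>c\<in>V \<rightarrow>\<^sub>E I. (\<Prod>v\<in>V. x (c v)) * ?ind S (restrict c S)) = colour_density F {..<?m} I x" .
  qed
  also have "\<dots> = real (card V choose ?m) * colour_density F {..<?m} I x"
    using V by (simp add: n_subsets)
  finally show ?thesis .
qed

lemma exists_colouring_above_mean:
  assumes V: "finite V" and prof: "profile I x"
  obtains c where "c \<in> V \<rightarrow>\<^sub>E I"
    "real (card V choose card (verts F)) * colour_density F {..<card (verts F)} I x
       \<le> real (induced_count F (colour_graph V c))"
proof -
  let ?M = "real (card V choose card (verts F)) * colour_density F {..<card (verts F)} I x"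
  let ?w = "\<lambda>c. \<Prod>v\<in>V. x (c v)" and ?P = "\<lambda>c. real (induced_count F (colour_graph V c))"
  have I: "finite I" "sum x I = 1" and pos: "\<And>q. q \<in> I \<Longrightarrow> x q > 0"
    using prof by (auto simp: profile_def)
  have total: "(\<Sum>c\<in>V \<rightarrow>\<^sub>E I. ?w c) = 1"
    using prod_sum_PiE[of V "\<lambda>_. I" "\<lambda>_. x"] V I by simp
  have wpos: "?w c > 0" if "c \<in> V \<rightarrow>\<^sub>E I" for c
    using that pos by (intro prod_pos) auto
  have "\<exists>c\<in>V \<rightarrow>\<^sub>E I. ?M \<le> ?P c"
  proof (rule ccontr)
    assume "\<not> ?thesis"
    then have less: "?P c < ?M" if "c \<in> V \<rightarrow>\<^sub>E I" for c using that by force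
    have "(\<Sum>c\<in>V \<rightarrow>\<^sub>E I. ?w c * ?P c) < (\<Sum>c\<in>V \<rightarrow>\<^sub>E I. ?w c * ?M)"
    proof (rule sum_strict_mono)
      show "finite (V \<rightarrow>\<^sub>E I)" using V I by (auto intro: finite_PiE)
      show "V \<rightarrow>\<^sub>E I \<noteq> {}" using total by force
    qed (use less wpos in \<open>auto intro!: mult_strict_left_mono\<close>)
    also have "\<dots> = ?M" unfolding sum_distrib_right[symmetric] total by simp
    finally show False using expected_induced_count[OF V prof, of F] by simp
  qed
  then show ?thesis using that by blast
qed

lemma simple_graph_colour_graph: "finite V \<Longrightarrow> simple_graph (colour_graph V c)"
  unfolding simple_graph_def colour_graph_def nsets_def by (auto simp: card_2_iff)

lemma not_contains_K_colour_graph: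
  assumes "finite I" "card I < k" "\<And>v. v \<in> V \<Longrightarrow> c v \<in> I"
  shows "\<not> contains_K k (colour_graph V c)"
proof
  assume "contains_K k (colour_graph V c)"
  then obtain S where S: "S \<subseteq> V" "card S = k" "clique S (edges (colour_graph V c))"
    by (auto simp: contains_K_def)
  then have "inj_on c S" by (auto simp: clique_def edge_colour_graph inj_on_def)
  then have "card S \<le> card I" using S assms by (intro card_inj_on_le[of c]) auto
  then show False using S assms by simp
qed

section \<open>Counting maps: the upper bound\<close>

lemma card_bijections_onto:
  assumes "finite S" "card S = m"
  shows "card {h \<in> {..<m} \<rightarrow>\<^sub>E S. inj_on h {..<m}} = fact m"
  using card_inj_on_subset_funcset[of "{..<m}" S "{..<m}"] assms by (simp add: fact_prod_rev)

text \<open>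
  Every copy of \<open>F\<close> is the image of \<open>m!\<close> injective maps from \<open>{..<m}\<close>. The right-hand side counts all
  maps, injective or not, that pull the colouring back to a copy of \<open>F\<close>.
\<close>

lemma induced_count_colour_graph_le:
  assumes V: "finite V" "V \<noteq> {}"
  shows "real (fact (card (verts F)) * induced_count F (colour_graph V c))
    \<le> real (card V) ^ card (verts F) *
       colour_density F {..<card (verts F)} (c ` V) (\<lambda>q. real (card {v \<in> V. c v = q}) / real (card V))"
proof -
  let ?m = "card (verts F)" and ?n = "real (card V)"
  let ?fib = "\<lambda>q. {v \<in> V. c v = q}"
  let ?H = "{h \<in> {..<?m} \<rightarrow>\<^sub>E V. graph_iso F (colour_graph {..<?m} (\<lambda>i. c (h i)))}"
  let ?D = "{d \<in> {..<?m} \<rightarrow>\<^sub>E c ` V. graph_iso F (colour_graph {..<?m} d)}"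
  have n: "?n > 0" using V by (simp add: card_gt_0_iff)
  have finH: "finite ?H"
    by (rule finite_subset[of _ "{..<?m} \<rightarrow>\<^sub>E V"]) (use V in \<open>auto intro: finite_PiE\<close>)
  have finD: "finite ?D"
    by (rule finite_subset[of _ "{..<?m} \<rightarrow>\<^sub>E c ` V"]) (use V in \<open>auto intro: finite_PiE\<close>)
  let ?C = "copies F (colour_graph V c)"
  let ?b = "\<lambda>S. {h \<in> {..<?m} \<rightarrow>\<^sub>E S. inj_on h {..<?m}}"
  have onto: "h ` {..<?m} = S" if "S \<in> ?C" "h \<in> ?b S" for S h
  proof (rule card_subset_eq)
    show "finite S" using that V finite_subset by (auto simp: copies_def)
    show "h ` {..<?m} \<subseteq> S" using that by auto
    show "card (h ` {..<?m}) = card S" using that by (auto simp: card_image copies_def)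
  qed
  have "card (\<Union>S\<in>?C. ?b S) = (\<Sum>S\<in>?C. card (?b S))"
  proof (rule card_UN_disjoint)
    show "finite ?C" using V by (intro finite_copies) simp
    show "\<forall>S\<in>?C. finite (?b S)"
    proof
      fix S assume "S \<in> ?C"
      then have "finite S" using V finite_subset by (auto simp: copies_def)
      then show "finite (?b S)"
        by (intro finite_subset[of "?b S" "{..<?m} \<rightarrow>\<^sub>E S"]) (auto intro: finite_PiE)
    qed
    show "\<forall>S\<in>?C. \<forall>T\<in>?C. S \<noteq> T \<longrightarrow> ?b S \<inter> ?b T = {}"
      using onto by (metis (no_types, lifting) disjoint_iff)
  qed
  also have "\<dots> = (\<Sum>S\<in>?C. fact ?m)"
  proof (rule sum.cong[OF refl])
    fix S assume "S \<in> ?C"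
    then have "finite S" "card S = ?m" using V finite_subset by (auto simp: copies_def)
    then show "card (?b S) = fact ?m" by (rule card_bijections_onto)
  qed
  finally have "fact ?m * induced_count F (colour_graph V c) = card (\<Union>S\<in>?C. ?b S)"
    by (simp add: induced_count_eq)
  also have "\<dots> \<le> card ?H"
  proof (rule card_mono[OF finH], rule subsetI)
    fix h assume "h \<in> (\<Union>S\<in>?C. ?b S)"
    then obtain S where S: "S \<in> ?C" and h: "h \<in> ?b S" by blast
    have sub: "S \<subseteq> V" and iso: "graph_iso F (colour_graph S (restrict c S))"
      using S by (auto simp: copies_def induced_subgraph_colour_graph)
    have hS: "h i \<in> S" if "i < ?m" for i using h that by auto
    have "bij_betw h {..<?m} S" using onto[OF S h] h by (simp add: bij_betw_def)
    from graph_iso_colour_graph_reindex[OF this, of "restrict c S"]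
    have "graph_iso (colour_graph {..<?m} (\<lambda>i. restrict c S (h i))) (colour_graph S (restrict c S))" .
    moreover have "colour_graph {..<?m} (\<lambda>i. restrict c S (h i)) = colour_graph {..<?m} (\<lambda>i. c (h i))"
      unfolding colour_graph_def using hS by auto
    ultimately have "graph_iso F (colour_graph {..<?m} (\<lambda>i. c (h i)))"
      using graph_iso_trans[OF iso graph_iso_sym] by simp
    then show "h \<in> ?H" using h sub by auto
  qed
  also have "\<dots> \<le> card (\<Union>d\<in>?D. PiE {..<?m} (\<lambda>i. ?fib (d i)))"
  proof (rule card_mono)
    show "finite (\<Union>d\<in>?D. PiE {..<?m} (\<lambda>i. ?fib (d i)))"
      using V by (intro finite_UN_I[OF finD] finite_PiE) simp_all
    show "?H \<subseteq> (\<Union>d\<in>?D. PiE {..<?m} (\<lambda>i. ?fib (d i)))"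
    proof
      fix h assume h: "h \<in> ?H"
      let ?d = "\<lambda>i\<in>{..<?m}. c (h i)"
      have "colour_graph {..<?m} ?d = colour_graph {..<?m} (\<lambda>i. c (h i))"
        unfolding colour_graph_def by auto
      then have "?d \<in> ?D" using h by auto
      moreover have "h \<in> PiE {..<?m} (\<lambda>i. ?fib (?d i))" using h by (auto simp: PiE_iff)
      ultimately show "h \<in> (\<Union>d\<in>?D. PiE {..<?m} (\<lambda>i. ?fib (d i)))" by blast
    qed
  qed
  also have "\<dots> \<le> (\<Sum>d\<in>?D. card (PiE {..<?m} (\<lambda>i. ?fib (d i))))"
    by (rule card_UN_le[OF finD])
  finally have "real (fact ?m * induced_count F (colour_graph V c))
      \<le> real (\<Sum>d\<in>?D. card (PiE {..<?m} (\<lambda>i. ?fib (d i))))"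
    by (simp only: of_nat_le_iff)
  also have "\<dots> = (\<Sum>d\<in>?D. \<Prod>i<?m. real (card (?fib (d i))))"
    by (simp add: card_PiE)
  also have "\<dots> = (\<Sum>d\<in>?D. ?n ^ ?m * (\<Prod>i<?m. real (card (?fib (d i))) / ?n))"
    using n by (simp add: prod_dividef)
  finally show ?thesis by (simp add: colour_density_def sum_distrib_left)
qed

lemma colour_density_nonneg: "profile I x \<Longrightarrow> colour_density F V I x \<ge> 0"
  unfolding colour_density_def
  by (intro sum_nonneg prod_nonneg ballI) (auto simp: profile_def intro: less_imp_le)

lemma colour_density_le_1:
  assumes "profile I x" "finite V" shows "colour_density F V I x \<le> 1"
proof -
  have "colour_density F V I x \<le> (\<Sum>c\<in>V \<rightarrow>\<^sub>E I. \<Prod>v\<in>V. x (c v))"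
    unfolding colour_density_def using assms
    by (intro sum_mono2 prod_nonneg) (auto simp: profile_def intro: finite_PiE less_imp_le)
  also have "\<dots> = 1"
    using prod_sum_PiE[of V "\<lambda>_. I" "\<lambda>_. x"] assms by (simp add: profile_def)
  finally show ?thesis .
qed

section \<open>The limits\<close>

definition K_free_graphs :: "nat \<Rightarrow> nat \<Rightarrow> nat graph set" where
  "K_free_graphs k n = {G. simple_graph G \<and> verts G = {..<n} \<and> \<not> contains_K k G}"

lemma finite_K_free_graphs: "finite (K_free_graphs k n)"
proof (rule finite_subset)
  show "K_free_graphs k n \<subseteq> {{..<n}} \<times> Pow (nsets {..<n} 2)"
    by (auto simp: K_free_graphs_def simple_graph_def)
qed (simp add: finite_imp_finite_nsets)

lemma K_free_inducibility_n_eq: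
  "K_free_inducibility_n k F n = Max (induced_density F ` K_free_graphs k n)"
  unfolding K_free_inducibility_n_def K_free_graphs_def
  by (rule arg_cong[of _ _ Max]) auto

text \<open>
  No graph with \<open>n\<close> vertices contains a clique of size \<open>n + 1\<close>, so results about \<open>i\<^sub>k\<close> cover the
  unrestricted case.
\<close>

lemma inducibility_n_eq: "inducibility_n F n = K_free_inducibility_n (Suc n) F n"
proof -
  have "\<not> contains_K (Suc n) G" if G: "verts G = {..<n}" for G :: "nat graph"
  proof
    assume "contains_K (Suc n) G"
    then obtain S where "S \<subseteq> {..<n}" "card S = Suc n" using G by (auto simp: contains_K_def)
    then show False using card_mono[of "{..<n}" S] by simp
  qed
  then show ?thesis
    unfolding inducibility_n_def K_free_inducibility_n_def
    by (intro arg_cong[of _ _ Max]) auto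
qed

text \<open>
  Some colouring of \<open>{..<n}\<close> attains at least the expectation, and with fewer than \<open>k\<close> colours it yields
  no clique of size \<open>k\<close>.
\<close>

lemma colour_density_le_K_free_inducibility_n:
  assumes prof: "profile I x" and k: "card I < k" and n: "card (verts F) \<le> n"
  shows "colour_density F {..<card (verts F)} I x \<le> K_free_inducibility_n k F n"
proof -
  obtain c where c: "c \<in> {..<n} \<rightarrow>\<^sub>E I" and
    le: "real (n choose card (verts F)) * colour_density F {..<card (verts F)} I x
       \<le> real (induced_count F (colour_graph {..<n} c))"
    using exists_colouring_above_mean[of "{..<n}" I x F] prof by auto
  have ch: "real (n choose card (verts F)) > 0" using n by simp
  have "colour_graph {..<n} c \<in> K_free_graphs k n"
    unfolding K_free_graphs_def using c k prof not_contains_K_colour_graph[of I k "{..<n}" c]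
    by (auto simp: simple_graph_colour_graph profile_def)
  then have "induced_density F (colour_graph {..<n} c) \<le> K_free_inducibility_n k F n"
    unfolding K_free_inducibility_n_eq using finite_K_free_graphs by (intro Max_ge) auto
  moreover have "colour_density F {..<card (verts F)} I x \<le> induced_density F (colour_graph {..<n} c)"
    unfolding induced_density_def using le ch by (simp add: field_simps)
  ultimately show ?thesis by linarith
qed

text \<open>
  Symmetrization provides an optimal complete partite graph, whose part proportions are the profile.
\<close>

lemma K_free_inducibility_n_le:
  fixes a :: "nat list"
  defines "F \<equiv> complete_partite a"
  assumes k: "k \<ge> 2" and n: "n > 0" "card (verts F) \<le> n"
  obtains I x where "profile I x" "card I < k"
    "K_free_inducibility_n k F n \<le> colour_density F {..<card (verts F)} I x *
       (real n ^ card (verts F) / (fact (card (verts F)) * real (n choose card (verts F))))"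
proof -
  let ?m = "card (verts F)"
  have "\<not> contains_K k ({..<n}, {} :: nat set set)"
  proof
    assume "contains_K k ({..<n}, {} :: nat set set)"
    then obtain S where S: "S \<subseteq> {..<n}" "card S = k" "clique S {}" by (auto simp: contains_K_def)
    then have "finite S" "\<forall>u\<in>S. \<forall>v\<in>S. u = v" by (auto simp: clique_def finite_subset)
    then have "card S \<le> 1" using card_le_Suc0_iff_eq[of S] by simp
    then show False using S k by simp
  qed
  then have "({..<n}, {}) \<in> K_free_graphs k n"
    by (simp add: K_free_graphs_def simple_graph_def)
  then have ne: "K_free_graphs k n \<noteq> {}" by blast
  obtain G where G: "G \<in> K_free_graphs k n"
    and max: "\<And>H. H \<in> K_free_graphs k n \<Longrightarrow> induced_count F H \<le> induced_count F G"
    and tw: "\<And>u v. u \<in> verts G \<Longrightarrow> v \<in> verts G \<Longrightarrow> {u, v} \<notin> edges G \<Longrightarrow> twins G u v"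
  proof (rule exists_symmetrized_maximizer[OF finite_K_free_graphs ne, of "induced_count F"])
    fix G :: "nat graph" and u v
    assume G: "G \<in> K_free_graphs k n" and uv: "u \<in> verts G" "v \<in> verts G" "{u, v} \<notin> edges G"
    then show "clone u v G \<in> K_free_graphs k n"
      using contains_K_clone[of G u v k] simple_graph_clone[of G u v] by (auto simp: K_free_graphs_def)
    assume "u \<noteq> v"
    then show "2 * induced_count F G \<le> induced_count F (clone u v G) + induced_count F (clone v u G)"
      using G uv unfolding F_def by (intro induced_count_clone_average) (auto simp: K_free_graphs_def)
  qed (use that in \<open>auto simp: K_free_graphs_def\<close>)
  have G': "simple_graph G" "verts G = {..<n}" "\<not> contains_K k G"
    using G by (auto simp: K_free_graphs_def)
  obtain c where c: "G = colour_graph {..<n} c" "card (c ` {..<n}) < k"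
    using nonadjacent_twins_imp_colour_graph[OF G'(1) tw G'(3)] unfolding G'(2) by metis
  let ?I = "c ` {..<n}" and ?x = "\<lambda>q. real (card {v \<in> {..<n}. c v = q}) / real n"
  have "(\<Sum>q\<in>?I. \<Sum>v\<in>{v \<in> {..<n}. c v = q}. 1 :: real) = (\<Sum>v<n. 1)"
    by (rule sum.group) auto
  then have "(\<Sum>q\<in>?I. real (card {v \<in> {..<n}. c v = q})) = real n"
    by (simp only: sum_constant card_lessThan mult_1_right)
  then have "sum ?x ?I = 1" using n by (simp only: sum_divide_distrib[symmetric]) simp
  moreover have "?x q > 0" if "q \<in> ?I" for q
  proof -
    have "{v \<in> {..<n}. c v = q} \<noteq> {}" "finite {v \<in> {..<n}. c v = q}" using that by auto
    then have "card {v \<in> {..<n}. c v = q} > 0" by (simp only: card_gt_0_iff simp_thms)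
    then show ?thesis using n by simp
  qed
  ultimately have prof: "profile ?I ?x" unfolding profile_def by blast
  have "K_free_inducibility_n k F n \<in> induced_density F ` K_free_graphs k n"
    unfolding K_free_inducibility_n_eq using finite_K_free_graphs ne by (intro Max_in) auto
  then obtain H where H: "H \<in> K_free_graphs k n" "K_free_inducibility_n k F n = induced_density F H"
    by auto
  have "card (verts H) = n" using H(1) by (simp add: K_free_graphs_def)
  then have "K_free_inducibility_n k F n = real (induced_count F H) / real (n choose ?m)"
    by (simp add: H(2) induced_density_def)
  also have "\<dots> \<le> real (induced_count F G) / real (n choose ?m)"
    using max[OF H(1)] by (intro divide_right_mono) auto
  also have "\<dots> \<le> (real n ^ ?m * colour_density F {..<?m} ?I ?x / fact ?m) / real (n choose ?m)"
  proof (rule divide_right_mono)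
    have "real (fact ?m * induced_count F G) \<le> real n ^ ?m * colour_density F {..<?m} ?I ?x"
    proof -
      have "{..<n} \<noteq> {}" using n by auto
      from induced_count_colour_graph_le[OF finite_lessThan this, of F c] show ?thesis
        by (simp only: c(1) card_lessThan)
    qed
    then show "real (induced_count F G) \<le> real n ^ ?m * colour_density F {..<?m} ?I ?x / fact ?m"
      by (simp add: field_simps)
  qed simp
  also have "\<dots> = colour_density F {..<?m} ?I ?x * (real n ^ ?m / (fact ?m * real (n choose ?m)))"
    by simp
  finally show ?thesis by (rule that[OF prof c(2)])
qed

lemma power_over_falling_factorial_tendsto_1:
  "(\<lambda>n. real n ^ m / (fact m * real (n choose m))) \<longlonglongrightarrow> 1"
proof -
  have "(\<lambda>n. \<Prod>i = 0..<m. 1 - real i / real n) \<longlonglongrightarrow> (\<Prod>i = 0..<m. 1 - 0)"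
    by (intro tendsto_intros lim_const_over_n)
  then have "(\<lambda>n. inverse (\<Prod>i = 0..<m. 1 - real i / real n)) \<longlonglongrightarrow> inverse 1"
    by (intro tendsto_inverse) auto
  moreover have "eventually (\<lambda>n. inverse (\<Prod>i = 0..<m. 1 - real i / real n)
      = real n ^ m / (fact m * real (n choose m))) sequentially"
    using eventually_gt_at_top[of 0]
  proof eventually_elim
    case (elim n)
    have "fact m * real (n choose m) = (\<Prod>i = 0..<m. real n - real i)"
      by (simp add: binomial_gbinomial gbinomial_mult_fact)
    also have "\<dots> = (\<Prod>i = 0..<m. real n * (1 - real i / real n))"
      using elim by (intro prod.cong) (auto simp: field_simps)
    also have "\<dots> = real n ^ m * (\<Prod>i = 0..<m. 1 - real i / real n)"
      by (simp add: prod.distrib)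
    finally show ?case using elim by (simp add: divide_simps)
  qed
  ultimately have "(\<lambda>n. real n ^ m / (fact m * real (n choose m))) \<longlonglongrightarrow> inverse 1"
    by (rule Lim_transform_eventually)
  then show ?thesis by simp
qed

text \<open>
  The upper bound may use a different \<open>y\<close> for every \<open>n\<close>, as the optimal graphs on different numbers of
  vertices need not have related profiles.
\<close>

lemma tendsto_Sup_squeeze:
  fixes h \<rho> :: "nat \<Rightarrow> real"
  assumes X: "X \<noteq> {}" "bdd_above X" "\<And>y. y \<in> X \<Longrightarrow> y \<ge> 0"
    and lower: "\<And>y. y \<in> X \<Longrightarrow> eventually (\<lambda>n. y \<le> h n) sequentially"
    and upper: "eventually (\<lambda>n. \<exists>y\<in>X. h n \<le> y * \<rho> n) sequentially"
    and \<rho>: "\<rho> \<longlonglongrightarrow> 1"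
  shows "h \<longlonglongrightarrow> Sup X"
proof (rule order_tendstoI)
  fix b assume "b < Sup X"
  then obtain y where y: "y \<in> X" "b < y" using less_cSup_iff[OF X(1,2)] by blast
  show "eventually (\<lambda>n. b < h n) sequentially"
    using lower[OF y(1)] by eventually_elim (use y in simp)
next
  fix b assume b: "Sup X < b"
  have "(\<lambda>n. Sup X * \<rho> n) \<longlonglongrightarrow> Sup X * 1" by (intro tendsto_intros \<rho>)
  then have "eventually (\<lambda>n. Sup X * \<rho> n < b) sequentially" using b order_tendstoD(2) by fastforce
  moreover have "eventually (\<lambda>n. \<rho> n > 0) sequentially" using \<rho> order_tendstoD(1) by fastforce
  ultimately show "eventually (\<lambda>n. h n < b) sequentially"
    using upper
  proof eventually_elim
    case (elim n)
    then obtain y where y: "y \<in> X" "h n \<le> y * \<rho> n" by blast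
    have "y * \<rho> n \<le> Sup X * \<rho> n"
      using cSup_upper[OF y(1) X(2)] elim by (intro mult_right_mono) auto
    then show ?case using y elim by linarith
  qed
qed

text \<open>
  The predicate restricts the number of parts: fewer than \<open>k\<close> for graphs without a clique of size \<open>k\<close>,
  any number for the unrestricted problem.
\<close>

definition profile_densities :: "'a graph \<Rightarrow> (nat \<Rightarrow> bool) \<Rightarrow> real set" where
  "profile_densities F P = {colour_density F {..<card (verts F)} I x | I x. profile I x \<and> P (card I)}"

lemma profile_densitiesI:
  "profile I x \<Longrightarrow> P (card I) \<Longrightarrow> colour_density F {..<card (verts F)} I x \<in> profile_densities F P"
  unfolding profile_densities_def by blast

lemma profile_densities_bounds:
  assumes "P 1"
  shows "profile_densities F P \<noteq> {}" "bdd_above (profile_densities F P)"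
    "\<And>y. y \<in> profile_densities F P \<Longrightarrow> y \<ge> 0"
proof -
  have "profile {0} (\<lambda>_. 1)" by (simp add: profile_def)
  then show "profile_densities F P \<noteq> {}" using assms unfolding profile_densities_def by fastforce
  show "bdd_above (profile_densities F P)"
    by (rule bdd_aboveI[of _ 1]) (auto simp: profile_densities_def intro: colour_density_le_1)
  show "y \<ge> 0" if "y \<in> profile_densities F P" for y
    using that by (auto simp: profile_densities_def intro: colour_density_nonneg)
qed

lemma K_free_inducibility_eq_Sup:
  assumes "k \<ge> 2"
  shows "K_free_inducibility k (complete_partite a) = Sup (profile_densities (complete_partite a) (\<lambda>l. l < k))"
proof -
  let ?F = "complete_partite a"
  let ?m = "card (verts ?F)"
  have "K_free_inducibility_n k ?F \<longlonglongrightarrow> Sup (profile_densities ?F (\<lambda>l. l < k))"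
  proof (rule tendsto_Sup_squeeze[OF profile_densities_bounds[of "\<lambda>l. l < k"] _ _
        power_over_falling_factorial_tendsto_1[of ?m]])
    fix y assume "y \<in> profile_densities ?F (\<lambda>l. l < k)"
    then obtain I x where "profile I x" "card I < k" "y = colour_density ?F {..<?m} I x"
      by (auto simp: profile_densities_def)
    note y = this
    show "eventually (\<lambda>n. y \<le> K_free_inducibility_n k ?F n) sequentially"
      using eventually_ge_at_top[of ?m]
      by eventually_elim (simp add: y colour_density_le_K_free_inducibility_n)
  next
    show "eventually (\<lambda>n. \<exists>y\<in>profile_densities ?F (\<lambda>l. l < k).
        K_free_inducibility_n k ?F n \<le> y * (real n ^ ?m / (fact ?m * real (n choose ?m)))) sequentially"
      using eventually_ge_at_top[of ?m] eventually_gt_at_top[of 0]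
    proof eventually_elim
      case (elim n)
      show ?case
        by (rule K_free_inducibility_n_le[OF assms elim(2,1)]) (auto simp: profile_densities_def)
    qed
  qed (use assms in auto)
  then show ?thesis unfolding K_free_inducibility_def by (rule limI)
qed

lemma inducibility_eq_Sup:
  "inducibility (complete_partite a) = Sup (profile_densities (complete_partite a) (\<lambda>_. True))"
proof -
  let ?F = "complete_partite a"
  let ?m = "card (verts ?F)"
  have "inducibility_n ?F \<longlonglongrightarrow> Sup (profile_densities ?F (\<lambda>_. True))"
  proof (rule tendsto_Sup_squeeze[OF profile_densities_bounds[of "\<lambda>_. True"] _ _
        power_over_falling_factorial_tendsto_1[of ?m]])
    fix y assume "y \<in> profile_densities ?F (\<lambda>_. True)"
    then obtain I x where "profile I x" "y = colour_density ?F {..<?m} I x"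
      by (auto simp: profile_densities_def)
    note y = this
    show "eventually (\<lambda>n. y \<le> inducibility_n ?F n) sequentially"
      using eventually_ge_at_top[of ?m] eventually_ge_at_top[of "card I"]
      by eventually_elim (simp add: y inducibility_n_eq colour_density_le_K_free_inducibility_n)
  next
    show "eventually (\<lambda>n. \<exists>y\<in>profile_densities ?F (\<lambda>_. True).
        inducibility_n ?F n \<le> y * (real n ^ ?m / (fact ?m * real (n choose ?m)))) sequentially"
      using eventually_ge_at_top[of ?m] eventually_gt_at_top[of 0]
    proof eventually_elim
      case (elim n)
      then have "Suc n \<ge> 2" by simp
      then show ?case unfolding inducibility_n_eq
        by (rule K_free_inducibility_n_le[OF _ elim(2,1)]) (auto simp: profile_densities_def)
    qed
  qed auto
  then show ?thesis unfolding inducibility_def by (rule limI)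
qed


section \<open>The dependence of the polynomial on two parts\<close>

lemma finite_injections [simp]: "finite R \<Longrightarrow> finite I \<Longrightarrow> finite (injections R I)"
  by (rule finite_subset[of _ "R \<rightarrow>\<^sub>E I"]) (auto simp: injections_def intro: finite_PiE)

lemma inj_sum_nonneg:
  assumes "\<And>q. q \<in> I \<Longrightarrow> x q \<ge> 0" shows "inj_sum a R I x \<ge> 0"
  unfolding inj_sum_def
  using assms by (intro sum_nonneg prod_nonneg zero_le_power ballI) (auto simp: injections_def)

lemma inj_sum_cong:
  assumes "\<And>q. q \<in> I \<Longrightarrow> x q = y q" shows "inj_sum a R I x = inj_sum a R I y"
  unfolding inj_sum_def
  by (intro sum.cong prod.cong refl arg_cong2[of _ _ _ _ "(^)"] assms) (auto simp: injections_def)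

lemma inj_sum_fix_part:
  assumes "finite R" "q \<in> I" "i \<in> R"
  shows "(\<Sum>\<phi>\<in>{\<phi> \<in> injections R I. \<phi> i = q}. \<Prod>j\<in>R. x (\<phi> j) ^ a j) =
         (x q :: real) ^ a i * inj_sum a (R - {i}) (I - {q}) x"
proof -
  have "(\<Sum>\<phi>\<in>{\<phi> \<in> injections R I. \<phi> i = q}. \<Prod>j\<in>R. x (\<phi> j) ^ a j) =
        (\<Sum>\<psi>\<in>injections (R - {i}) (I - {q}). x q ^ a i * (\<Prod>j\<in>R - {i}. x (\<psi> j) ^ a j))"
  proof (rule sum.reindex_bij_witness[of _ "\<lambda>\<psi>. \<psi>(i := q)" "\<lambda>\<phi>. restrict \<phi> (R - {i})"], goal_cases)
    case (1 \<phi>)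
    have "(restrict \<phi> (R - {i}))(i := q) = restrict \<phi> R" using 1 assms by (auto simp: fun_eq_iff)
    then show ?case using 1 by (simp add: injections_def PiE_iff extensional_restrict)
  next
    case (2 \<phi>)
    then show ?case using assms by (auto simp: injections_def inj_on_def)
  next
    case (3 \<psi>)
    have "restrict (\<psi>(i := q)) (R - {i}) = restrict \<psi> (R - {i})" by (auto simp: fun_eq_iff)
    then show ?case using 3 by (simp add: injections_def PiE_iff extensional_restrict)
  next
    case (4 \<psi>)
    then have "\<psi> j \<in> I" "\<psi> j \<noteq> q" if "j \<in> R" "j \<noteq> i" for j
      using that by (auto simp: injections_def)
    moreover have "inj_on \<psi> (R - {i})" "\<psi> \<in> extensional (R - {i})"
      using 4 by (auto simp: injections_def PiE_iff)
    \<comment> \<open>Injectivity is preserved because \<open>\<psi>\<close> avoids \<open>q\<close>.\<close>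
    moreover from calculation have "inj_on (\<psi>(i := q)) (insert i (R - {i}))"
      unfolding inj_on_insert by (auto simp: inj_on_def)
    moreover have "insert i (R - {i}) = R" using assms by auto
    ultimately show ?case
      using assms by (auto simp: injections_def PiE_iff extensional_def)
  next
    case (5 \<phi>)
    then show ?case using assms by (simp add: prod.remove[of R i])
  qed
  then show ?thesis by (simp add: inj_sum_def sum_distrib_left)
qed

text \<open>
  An injection either avoids the part \<open>q\<close>, or uses it for exactly one part of \<open>F\<close>.
\<close>

lemma inj_sum_split_part:
  assumes "finite R" "finite I" "q \<in> I"
  shows "inj_sum a R I x = inj_sum a R (I - {q}) x
           + (\<Sum>i\<in>R. x q ^ a i * inj_sum a (R - {i}) (I - {q}) x)"
proof -
  let ?A = "\<lambda>i. {\<phi> \<in> injections R I. \<phi> i = q}"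
  let ?g = "\<lambda>\<phi>. \<Prod>j\<in>R. x (\<phi> j) ^ a j"
  have un: "injections R I = injections R (I - {q}) \<union> (\<Union>i\<in>R. ?A i)"
    by (auto simp: injections_def PiE_iff)
  have "inj_sum a R I x = sum ?g (injections R (I - {q})) + sum ?g (\<Union>i\<in>R. ?A i)"
    unfolding inj_sum_def
  proof (subst un, rule sum.union_disjoint)
    show "finite (injections R (I - {q}))" "finite (\<Union>i\<in>R. ?A i)" using assms by auto
    show "injections R (I - {q}) \<inter> (\<Union>i\<in>R. ?A i) = {}" by (auto simp: injections_def)
  qed
  also have "sum ?g (\<Union>i\<in>R. ?A i) = (\<Sum>i\<in>R. sum ?g (?A i))"
  proof (rule sum.UNION_disjoint)
    show "\<forall>i\<in>R. finite (?A i)" using assms by simp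
    show "\<forall>i\<in>R. \<forall>j\<in>R. i \<noteq> j \<longrightarrow> ?A i \<inter> ?A j = {}"
      by (auto simp: injections_def inj_on_def)
  qed fact
  finally show ?thesis
    using assms by (simp add: inj_sum_fix_part inj_sum_def[of a R "I - {q}"])
qed

text \<open>
  This exhibits the polynomial as a function of two part sizes. Perturbing equal parts and merging tiny
  parts both change only \<open>x p\<close> and \<open>x q\<close>, so they are analysed with this formula.
\<close>

lemma inj_sum_split_two_parts:
  assumes "finite R" "finite I" "p \<in> I" "q \<in> I" "p \<noteq> q"
  shows "inj_sum a R I x = inj_sum a R (I - {p, q}) x
           + (\<Sum>i\<in>R. (x p ^ a i + x q ^ a i) * inj_sum a (R - {i}) (I - {p, q}) x)
           + (\<Sum>i\<in>R. \<Sum>j\<in>R - {i}. x p ^ a i * x q ^ a j * inj_sum a (R - {i, j}) (I - {p, q}) x)"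
proof -
  have J: "I - {p} - {q} = I - {p, q}" by auto
  have "inj_sum a R I x = inj_sum a R (I - {p}) x
          + (\<Sum>i\<in>R. x p ^ a i * inj_sum a (R - {i}) (I - {p}) x)"
    using assms by (intro inj_sum_split_part) auto
  moreover have "inj_sum a R (I - {p}) x = inj_sum a R (I - {p, q}) x
          + (\<Sum>i\<in>R. x q ^ a i * inj_sum a (R - {i}) (I - {p, q}) x)"
    using inj_sum_split_part[of R "I - {p}" q a x] assms by (simp add: J)
  moreover have "(\<Sum>i\<in>R. x p ^ a i * inj_sum a (R - {i}) (I - {p}) x) =
      (\<Sum>i\<in>R. x p ^ a i * inj_sum a (R - {i}) (I - {p, q}) x
        + (\<Sum>j\<in>R - {i}. x p ^ a i * x q ^ a j * inj_sum a (R - {i, j}) (I - {p, q}) x))"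
  proof (intro sum.cong refl)
    fix i
    have "R - {i} - {j} = R - {i, j}" for j by auto
    then show "x p ^ a i * inj_sum a (R - {i}) (I - {p}) x =
      x p ^ a i * inj_sum a (R - {i}) (I - {p, q}) x
        + (\<Sum>j\<in>R - {i}. x p ^ a i * x q ^ a j * inj_sum a (R - {i, j}) (I - {p, q}) x)"
      using inj_sum_split_part[of "R - {i}" "I - {p}" q a x] assms
      by (simp add: J distrib_left sum_distrib_left mult.assoc)
  qed
  ultimately show ?thesis by (simp add: sum.distrib distrib_right)
qed

lemma inj_sum_pos:
  assumes "finite R" "finite I" "card R \<le> card I" and pos: "\<And>q. q \<in> I \<Longrightarrow> x q > 0"
  shows "inj_sum a R I x > 0"
proof -
  obtain f where f: "f ` R \<subseteq> I" "inj_on f R"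
    using assms by (meson card_le_inj)
  have "restrict f R \<in> injections R I" using f by (auto simp: injections_def inj_on_def)
  moreover have "(\<Prod>i\<in>R. x (\<phi> i) ^ a i) > 0" if "\<phi> \<in> injections R I" for \<phi>
    using that pos by (intro prod_pos zero_less_power ballI) (auto simp: injections_def)
  ultimately show ?thesis
    unfolding inj_sum_def using assms by (intro sum_pos) auto
qed

lemma inj_sum_eq_0:
  assumes "finite I" "card I < card R" shows "inj_sum a R I x = 0"
proof -
  have "injections R I = {}"
    using assms card_inj_on_le[of _ R I] by (fastforce simp: injections_def)
  then show ?thesis by (simp add: inj_sum_def)
qed

section \<open>Equal parts can be perturbed\<close>

text \<open>
  The sum and the difference of the two powers satisfy a mutual recursion, so the two bounds have to be
  proved simultaneously.
\<close>

lemma binomial_pair_lower_bounds: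
  fixes e :: real assumes "0 \<le> e" "e \<le> 1"
  shows "(1 + e) ^ d + (1 - e) ^ d \<ge> 2 + real d * (real d - 1) * e\<^sup>2"
    and "(1 + e) ^ d - (1 - e) ^ d \<ge> 2 * real d * e"
proof (induction d)
  case (Suc d)
  case 1
  have "(1 + e) ^ Suc d + (1 - e) ^ Suc d =
        ((1 + e) ^ d + (1 - e) ^ d) + e * ((1 + e) ^ d - (1 - e) ^ d)"
    by (simp add: algebra_simps)
  also have "\<dots> \<ge> (2 + real d * (real d - 1) * e\<^sup>2) + e * (2 * real d * e)"
    by (intro add_mono mult_left_mono Suc.IH assms)
  finally show ?case by (simp add: algebra_simps power2_eq_square)
next
  case (Suc d)
  case 2
  have "real d * (real d - 1) * e\<^sup>2 \<ge> 0" by (cases d) auto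
  then have "(1 + e) ^ d + (1 - e) ^ d \<ge> 2" using Suc by linarith
  then have "e * ((1 + e) ^ d + (1 - e) ^ d) \<ge> e * 2" using assms by (intro mult_left_mono) auto
  moreover have "(1 + e) ^ Suc d - (1 - e) ^ Suc d =
        ((1 + e) ^ d - (1 - e) ^ d) + e * ((1 + e) ^ d + (1 - e) ^ d)"
    by (simp add: algebra_simps)
  ultimately show ?case using Suc by (simp add: algebra_simps)
qed (use assms in auto)

lemma binomial_pair_ge_2:
  fixes e :: real assumes "0 \<le> e" "e \<le> 1"
  shows "(1 + e) ^ d + (1 - e) ^ d \<ge> 2"
proof -
  have "real d * (real d - 1) * e\<^sup>2 \<ge> 0" by (cases d) auto
  then show ?thesis using binomial_pair_lower_bounds(1)[OF assms, of d] by linarith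
qed

text \<open>
  With \<open>d = a - b\<close> the sum equals \<open>(1 - e\<^sup>2) ^ b * ((1 + e) ^ d + (1 - e) ^ d)\<close>. The first factor is at
  least \<open>1 - b * e\<^sup>2\<close>, the second one at least \<open>2 + d * (d - 1) * e\<^sup>2\<close>, and strong unbalancedness says
  \<open>d * (d - 1) > 2 * b\<close>. The last hypothesis makes the fourth-order term harmless.
\<close>

lemma unbalanced_pair_gain:
  fixes a b :: nat
  assumes "b \<le> a" and unb: "(int a - int b)\<^sup>2 > int a + int b"
    and e: "0 < e" "e < 1" "e\<^sup>2 * (1 + real b * real a ^ 2) < 1"
  shows "(1 + e) ^ a * (1 - e) ^ b + (1 + e) ^ b * (1 - e) ^ a > (2 :: real)"
proof -
  define d where "d = a - b"
  have a: "a = b + d" using assms d_def by simp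
  define D where "D = real d * (real d - 1) / 2"
  have "int d * int d \<ge> 2 * int b + int d + 1" using unb by (simp add: a power2_eq_square)
  then have "real_of_int (int d * int d) \<ge> real_of_int (2 * int b + int d + 1)"
    by (simp only: of_int_le_iff)
  then have gap: "D - real b \<ge> 1 / 2" by (simp add: D_def field_simps)
  have D0: "D \<ge> 0" using gap of_nat_0_le_iff[of b, where 'a = real] by linarith
  have DA: "2 * D \<le> real a ^ 2"
  proof -
    have "real d * (real d - 1) \<le> real d * real d"
      by (intro mult_left_mono) auto
    also have "\<dots> \<le> real a * real a"
      by (intro mult_mono) (auto simp: a)
    finally have "real d * (real d - 1) \<le> real a * real a" .
    then show ?thesis by (simp add: D_def power2_eq_square)
  qed
  have e1: "e\<^sup>2 < 1" using e by (simp add: power_less_one_iff)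
  have "(1 - e\<^sup>2) ^ b \<ge> 1 - real b * e\<^sup>2"
    using Bernoulli_inequality[of "- e\<^sup>2" b] e1 by simp
  moreover have "(1 + e) ^ d + (1 - e) ^ d \<ge> 2 * (1 + D * e\<^sup>2)"
  proof -
    have "2 * (1 + D * e\<^sup>2) = 2 + real d * (real d - 1) * e\<^sup>2" by (simp add: D_def)
    moreover have "(1 + e) ^ d + (1 - e) ^ d \<ge> 2 + real d * (real d - 1) * e\<^sup>2"
      using e by (intro binomial_pair_lower_bounds) auto
    ultimately show ?thesis by linarith
  qed
  ultimately have "(1 - e\<^sup>2) ^ b * ((1 + e) ^ d + (1 - e) ^ d) \<ge> (1 - real b * e\<^sup>2) * (2 * (1 + D * e\<^sup>2))"
    using D0 e1 by (intro mult_mono) auto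
  moreover have "(1 - real b * e\<^sup>2) * (2 * (1 + D * e\<^sup>2)) = 2 + e\<^sup>2 * (2 * (D - b) - e\<^sup>2 * (real b * (2 * D)))"
    by (simp add: algebra_simps power2_eq_square)
  moreover have "e\<^sup>2 * (2 * (D - b) - e\<^sup>2 * (real b * (2 * D))) > 0"
  proof (rule mult_pos_pos)
    have "e\<^sup>2 * (real b * (2 * D)) \<le> e\<^sup>2 * (real b * real a ^ 2)"
      using DA by (intro mult_left_mono) auto
    also have "\<dots> \<le> e\<^sup>2 * (1 + real b * real a ^ 2)" by (intro mult_left_mono) auto
    also have "\<dots> < 1" by (rule e(3))
    finally have small: "e\<^sup>2 * (real b * (2 * D)) < 1" .
    have "2 * (D - b) - z > 0" if "z < 1" for z using gap that by argo
    then show "2 * (D - b) - e\<^sup>2 * (real b * (2 * D)) > 0" using small .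
  qed (use e in simp)
  moreover have "(1 + e) ^ a * (1 - e) ^ b + (1 + e) ^ b * (1 - e) ^ a =
        (1 - e\<^sup>2) ^ b * ((1 + e) ^ d + (1 - e) ^ d)"
  proof -
    have "(1 - e\<^sup>2) ^ b = (1 + e) ^ b * (1 - e) ^ b"
      by (simp add: power_mult_distrib[symmetric] algebra_simps power2_eq_square)
    then show ?thesis by (simp add: a power_add algebra_simps)
  qed
  ultimately show ?thesis by linarith
qed

lemma eventually_unbalanced_pair_gain:
  fixes a b :: nat
  assumes unb: "(int a - int b)\<^sup>2 > int a + int b"
  shows "eventually (\<lambda>e. (1 + e) ^ a * (1 - e) ^ b + (1 + e) ^ b * (1 - e) ^ a > (2 :: real)) (at_right 0)"
proof -
  have small: "eventually (\<lambda>e::real. e\<^sup>2 * (1 + real l * real k ^ 2) < 1) (at_right 0)" for k l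
  proof (rule order_tendstoD)
    show "((\<lambda>e::real. e\<^sup>2 * (1 + real l * real k ^ 2)) \<longlongrightarrow> 0\<^sup>2 * (1 + real l * real k ^ 2)) (at_right 0)"
      by (intro tendsto_intros)
  qed simp
  have unit: "eventually (\<lambda>e::real. 0 < e \<and> e < 1) (at_right 0)"
    by (auto simp: eventually_at_right_field intro: exI[of _ 1])
  show ?thesis
  proof (cases "b \<le> a")
    case True
    show ?thesis
      using small[of b a] unit by eventually_elim (use unbalanced_pair_gain[OF True unb] in auto)
  next
    case False
    then have le: "a \<le> b" by simp
    have unb': "(int b - int a)\<^sup>2 > int b + int a" using unb by (simp add: power2_commute)
    show ?thesis
      using small[of a b] unit
      by eventually_elim (use unbalanced_pair_gain[OF le unb'] in \<open>auto simp: algebra_simps\<close>)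
  qed
qed

text \<open>
  Two equal parts can always be changed to increase the polynomial. In the formula for two parts, the
  terms with one part of \<open>F\<close> do not decrease, and the terms with two parts increase strictly once the
  two ways of placing them are taken together. The coefficients of the latter are positive because
  there are enough parts to host the remaining parts of \<open>F\<close>.
\<close>

lemma inj_sum_less_perturbed:
  assumes fin: "finite R" "finite I" and cards: "2 \<le> card R" "card R \<le> card I"
    and unb: "\<And>i j. i \<in> R \<Longrightarrow> j \<in> R \<Longrightarrow> i \<noteq> j \<Longrightarrow> (int (a i) - int (a j))\<^sup>2 > int (a i) + int (a j)"
    and pos: "\<And>s. s \<in> I \<Longrightarrow> x s > 0" and pq: "p \<in> I" "q \<in> I" "p \<noteq> q" "x p = x q"
  obtains h where "0 < h" "h < x p" "inj_sum a R I x < inj_sum a R I (x(p := x p + h, q := x q - h))"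
proof -
  have "eventually (\<lambda>e::real. \<forall>z\<in>{(i, j). i \<in> R \<and> j \<in> R \<and> i \<noteq> j}.
          (1 + e) ^ a (fst z) * (1 - e) ^ a (snd z) + (1 + e) ^ a (snd z) * (1 - e) ^ a (fst z) > 2) (at_right 0)"
    using fin unb
    by (intro eventually_ball_finite ballI eventually_unbalanced_pair_gain)
       (auto intro: finite_subset[of _ "R \<times> R"])
  moreover have "eventually (\<lambda>e::real. 0 < e \<and> e < 1) (at_right 0)"
    by (auto simp: eventually_at_right_field intro: exI[of _ 1])
  ultimately have "eventually (\<lambda>e::real. (\<forall>z\<in>{(i, j). i \<in> R \<and> j \<in> R \<and> i \<noteq> j}.
          (1 + e) ^ a (fst z) * (1 - e) ^ a (snd z) + (1 + e) ^ a (snd z) * (1 - e) ^ a (fst z) > 2)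
          \<and> 0 < e \<and> e < 1) (at_right 0)"
    by (rule eventually_conj)
  from eventually_happens[OF this] obtain e :: real where e: "0 < e" "e < 1"
    and gain: "\<And>i j. i \<in> R \<Longrightarrow> j \<in> R \<Longrightarrow> i \<noteq> j \<Longrightarrow>
      (1 + e) ^ a i * (1 - e) ^ a j + (1 + e) ^ a j * (1 - e) ^ a i > 2"
    by auto
  define t where "t = x p"
  \<comment> \<open>A relative perturbation, so that every placement of two parts of \<open>F\<close> scales by a power of \<open>t\<close>.\<close>
  define y where "y = x(p := t * (1 + e), q := t * (1 - e))"
  have t: "t > 0" "x p = t" "x q = t" using pos pq by (auto simp: t_def)
  have yp: "y p = t * (1 + e)" "y q = t * (1 - e)" using pq by (auto simp: y_def)
  have ypow: "y p ^ k = t ^ k * (1 + e) ^ k" "y q ^ k = t ^ k * (1 - e) ^ k" for k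
    by (simp_all only: yp power_mult_distrib)
  let ?J = "I - {p, q}"
  have yJ: "inj_sum a S ?J y = inj_sum a S ?J x" for S by (rule inj_sum_cong) (auto simp: y_def)
  have nn: "inj_sum a S ?J x \<ge> 0" for S using pos by (intro inj_sum_nonneg less_imp_le) auto
  have single: "(x p ^ a i + x q ^ a i) * inj_sum a (R - {i}) ?J x
      \<le> (y p ^ a i + y q ^ a i) * inj_sum a (R - {i}) ?J x" for i
  proof (rule mult_right_mono[OF _ nn])
    have "t ^ a i * 2 \<le> t ^ a i * ((1 + e) ^ a i + (1 - e) ^ a i)"
      using t e by (intro mult_left_mono binomial_pair_ge_2) auto
    then show "x p ^ a i + x q ^ a i \<le> y p ^ a i + y q ^ a i"
      by (simp add: t ypow distrib_left)
  qed
  let ?C = "\<lambda>i j. inj_sum a (R - {i, j}) ?J x"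
  let ?P = "{(i, j). i \<in> R \<and> j \<in> R \<and> i \<noteq> j}"
  have finP: "finite ?P" using fin by (auto intro: finite_subset[of _ "R \<times> R"])
  \<comment> \<open>The coefficient is symmetric in \<open>i\<close> and \<open>j\<close>, so both placements of a pair can be grouped.\<close>
  have pairs: "(\<Sum>i\<in>R. \<Sum>j\<in>R - {i}. z p ^ a i * z q ^ a j * ?C i j) =
      (\<Sum>(i, j)\<in>?P. (z p ^ a i * z q ^ a j + z p ^ a j * z q ^ a i) * ?C i j) / 2" for z :: "nat \<Rightarrow> real"
  proof -
    let ?f = "\<lambda>i j. z p ^ a i * z q ^ a j * ?C i j"
    have "(\<Sum>i\<in>R. \<Sum>j\<in>R - {i}. ?f i j) = (\<Sum>(i, j)\<in>?P. ?f i j)"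
      using fin by (subst sum.Sigma) (auto intro!: sum.cong)
    moreover have "(\<Sum>(i, j)\<in>?P. ?f i j) = (\<Sum>(i, j)\<in>?P. ?f j i)"
      by (rule sum.reindex_bij_witness[of _ prod.swap prod.swap]) auto
    moreover have "(\<Sum>(i, j)\<in>?P. (z p ^ a i * z q ^ a j + z p ^ a j * z q ^ a i) * ?C i j) =
        (\<Sum>(i, j)\<in>?P. ?f i j) + (\<Sum>(i, j)\<in>?P. ?f j i)"
      unfolding sum.distrib[symmetric]
      by (intro sum.cong) (auto simp: algebra_simps insert_commute)
    ultimately show ?thesis by simp
  qed
  have "(\<Sum>(i, j)\<in>?P. (x p ^ a i * x q ^ a j + x p ^ a j * x q ^ a i) * ?C i j) <
        (\<Sum>(i, j)\<in>?P. (y p ^ a i * y q ^ a j + y p ^ a j * y q ^ a i) * ?C i j)"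
  proof (rule sum_strict_mono[OF finP])
    have "\<not> card R \<le> 1" using cards by simp
    then show "?P \<noteq> {}" using fin(1) card_le_Suc0_iff_eq[of R] by auto
    fix z assume "z \<in> ?P"
    then obtain i j where z: "z = (i, j)" and ij: "i \<in> R" "j \<in> R" "i \<noteq> j" by auto
    have "card (R - {i, j}) \<le> card ?J" using cards ij pq fin by (simp add: card_Diff_subset)
    then have C: "?C i j > 0" using fin pos by (intro inj_sum_pos) auto
    have "t ^ (a i + a j) * 2 < t ^ (a i + a j) * ((1 + e) ^ a i * (1 - e) ^ a j + (1 + e) ^ a j * (1 - e) ^ a i)"
      using t gain[OF ij] by (intro mult_strict_left_mono) auto
    then have "x p ^ a i * x q ^ a j + x p ^ a j * x q ^ a i < y p ^ a i * y q ^ a j + y p ^ a j * y q ^ a i"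
      by (simp add: t ypow power_add distrib_left mult_ac)
    then show "(case z of (i, j) \<Rightarrow> (x p ^ a i * x q ^ a j + x p ^ a j * x q ^ a i) * ?C i j) <
        (case z of (i, j) \<Rightarrow> (y p ^ a i * y q ^ a j + y p ^ a j * y q ^ a i) * ?C i j)"
      using C by (simp add: z mult_strict_right_mono)
  qed
  then have "(\<Sum>i\<in>R. \<Sum>j\<in>R - {i}. x p ^ a i * x q ^ a j * ?C i j)
           < (\<Sum>i\<in>R. \<Sum>j\<in>R - {i}. y p ^ a i * y q ^ a j * ?C i j)"
    unfolding pairs by simp
  moreover have "(\<Sum>i\<in>R. (x p ^ a i + x q ^ a i) * inj_sum a (R - {i}) ?J x)
      \<le> (\<Sum>i\<in>R. (y p ^ a i + y q ^ a i) * inj_sum a (R - {i}) ?J x)"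
    by (intro sum_mono single)
  ultimately have "inj_sum a R I x < inj_sum a R I y"
    unfolding inj_sum_split_two_parts[OF fin pq(1-3), of a x] inj_sum_split_two_parts[OF fin pq(1-3), of a y] yJ
    by linarith
  moreover have "y = x(p := x p + t * e, q := x q - t * e)"
    by (simp add: y_def t algebra_simps)
  ultimately show ?thesis using t e by (intro that[of "t * e"]) auto
qed


section \<open>Merging tiny parts\<close>

text \<open>
  Dropping the injectivity requirement makes the sum factor. The sets \<open>B i\<close> allow to confine a single
  part of \<open>F\<close> to small parts of the graphon.
\<close>

lemma inj_sum_le_prod_sum:
  fixes x :: "nat \<Rightarrow> real"
  assumes "finite R" "finite I" "\<And>i. i \<in> R \<Longrightarrow> B i \<subseteq> I" and nonneg: "\<And>q. q \<in> I \<Longrightarrow> x q \<ge> 0"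
  shows "(\<Sum>\<phi>\<in>{\<phi> \<in> injections R I. \<forall>i\<in>R. \<phi> i \<in> B i}. \<Prod>i\<in>R. x (\<phi> i) ^ a i) \<le> (\<Prod>i\<in>R. \<Sum>q\<in>B i. x q ^ a i)"
proof -
  have fin: "finite (B i)" if "i \<in> R" for i using assms(2,3) that by (meson finite_subset)
  have "(\<Sum>\<phi>\<in>{\<phi> \<in> injections R I. \<forall>i\<in>R. \<phi> i \<in> B i}. \<Prod>i\<in>R. x (\<phi> i) ^ a i)
      \<le> (\<Sum>\<phi>\<in>PiE R B. \<Prod>i\<in>R. x (\<phi> i) ^ a i)"
  proof (rule sum_mono2)
    show "finite (PiE R B)" using assms fin by (intro finite_PiE) auto
    show "{\<phi> \<in> injections R I. \<forall>i\<in>R. \<phi> i \<in> B i} \<subseteq> PiE R B"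
      by (auto simp: injections_def PiE_iff extensional_def)
    fix \<phi> assume "\<phi> \<in> PiE R B - {\<phi> \<in> injections R I. \<forall>i\<in>R. \<phi> i \<in> B i}"
    then have "\<phi> i \<in> I" if "i \<in> R" for i using assms(3) that by blast
    then show "(\<Prod>i\<in>R. x (\<phi> i) ^ a i) \<ge> 0" using nonneg by (intro prod_nonneg) auto
  qed
  then show ?thesis using prod_sum_PiE[of R B "\<lambda>i q. x q ^ a i"] assms fin by simp
qed

lemma power_sum_le:
  assumes "finite I" "B \<subseteq> I" and nonneg: "\<And>q. q \<in> I \<Longrightarrow> x q \<ge> 0" and "sum x I \<le> 1" and "a \<ge> 1"
  shows "(\<Sum>q\<in>B. x q ^ a) \<le> (1 :: real)"
proof -
  have le1: "x q \<le> 1" if "q \<in> I" for q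
    using member_le_sum[of q I x] assms that by fastforce
  have "(\<Sum>q\<in>B. x q ^ a) \<le> (\<Sum>q\<in>B. x q)"
  proof (rule sum_mono)
    fix q assume "q \<in> B"
    then show "x q ^ a \<le> x q"
      using power_decreasing[of 1 a "x q"] le1 nonneg assms(2,5) by auto
  qed
  also have "\<dots> \<le> sum x I" using assms by (intro sum_mono2) auto
  finally show ?thesis using assms by simp
qed

lemma inj_sum_le_1:
  assumes "finite R" "finite I" and nonneg: "\<And>q. q \<in> I \<Longrightarrow> x q \<ge> 0" and "sum x I \<le> 1"
    and "\<And>i. i \<in> R \<Longrightarrow> a i \<ge> 1"
  shows "inj_sum a R I x \<le> 1"
proof -
  have "inj_sum a R I x = (\<Sum>\<phi>\<in>{\<phi> \<in> injections R I. \<forall>i\<in>R. \<phi> i \<in> I}. \<Prod>i\<in>R. x (\<phi> i) ^ a i)"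
    unfolding inj_sum_def by (intro sum.cong) (auto simp: injections_def)
  also have "\<dots> \<le> (\<Prod>i\<in>R. \<Sum>q\<in>I. x q ^ a i)" using assms by (intro inj_sum_le_prod_sum) auto
  also have "\<dots> \<le> 1" using assms by (intro prod_le_1 conjI sum_nonneg power_sum_le) auto
  finally show ?thesis .
qed

text \<open>
  If fewer than \<open>card R - 1\<close> parts have size at least \<open>\<delta>\<close>, every injection sends some \<open>i \<noteq> i0\<close> to a part
  smaller than \<open>\<delta>\<close>. As \<open>x q ^ a i \<le> \<delta> * x q\<close> there, the injections that do so for a given \<open>i\<close>
  contribute at most \<open>\<delta>\<close>. The index \<open>i0\<close> is the only one whose exponent may be 1, and the bound would
  fail for it.
\<close>

lemma many_big_parts:
  assumes fin: "finite R" "finite I" and nonneg: "\<And>q. q \<in> I \<Longrightarrow> x q \<ge> 0" and sum: "sum x I \<le> 1"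
    and a1: "\<And>i. i \<in> R \<Longrightarrow> a i \<ge> 1" and i0: "i0 \<in> R" and a2: "\<And>i. i \<in> R \<Longrightarrow> i \<noteq> i0 \<Longrightarrow> a i \<ge> 2"
    and \<delta>: "\<delta> \<ge> 0" and large: "inj_sum a R I x > real (card R) * \<delta>"
  shows "card {q \<in> I. x q \<ge> \<delta>} \<ge> card R - 1"
proof (rule ccontr)
  let ?Big = "{q \<in> I. x q \<ge> \<delta>}" and ?R = "R - {i0}"
  let ?g = "\<lambda>\<phi>. \<Prod>i\<in>R. x (\<phi> i) ^ a i"
  assume small: "\<not> card ?Big \<ge> card R - 1"
  have missed: "\<exists>i\<in>?R. \<phi> i \<notin> ?Big" if "\<phi> \<in> injections R I" for \<phi>
  proof (rule ccontr)
    assume "\<not> ?thesis"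
    then have "card ?R \<le> card ?Big"
      using that fin by (intro card_inj_on_le[of \<phi>]) (auto simp: injections_def inj_on_def)
    then show False using small i0 fin by simp
  qed
  have g0: "?g \<phi> \<ge> 0" if "\<phi> \<in> injections R I" for \<phi>
    using that nonneg by (intro prod_nonneg zero_le_power ballI) (auto simp: injections_def)
  have each: "(\<Sum>\<phi>\<in>injections R I. if \<phi> i \<notin> ?Big then ?g \<phi> else 0) \<le> \<delta>" if i: "i \<in> ?R" for i
  proof -
    let ?B = "\<lambda>j. if j = i then I - ?Big else I"
    have iR: "i \<in> R" using i by simp
    have "(\<Sum>\<phi>\<in>injections R I. if \<phi> i \<notin> ?Big then ?g \<phi> else 0) =
          (\<Sum>\<phi>\<in>{\<phi> \<in> injections R I. \<forall>j\<in>R. \<phi> j \<in> ?B j}. ?g \<phi>)"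
    proof -
      have "{\<phi> \<in> injections R I. \<forall>j\<in>R. \<phi> j \<in> ?B j} = {\<phi> \<in> injections R I. \<phi> i \<notin> ?Big}"
        using iR by (auto simp: injections_def)
      then show ?thesis using fin by (simp only: sum.inter_filter finite_injections)
    qed
    also have "\<dots> \<le> (\<Prod>j\<in>R. \<Sum>q\<in>?B j. x q ^ a j)"
      using fin nonneg by (intro inj_sum_le_prod_sum) auto
    also have "\<dots> = (\<Sum>q\<in>I - ?Big. x q ^ a i) * (\<Prod>j\<in>R - {i}. \<Sum>q\<in>I. x q ^ a j)"
      using iR fin by (subst prod.remove[of R i]) auto
    also have "\<dots> \<le> \<delta> * 1"
    proof (rule mult_mono)
      have "(\<Sum>q\<in>I - ?Big. x q ^ a i) \<le> (\<Sum>q\<in>I - ?Big. \<delta> * x q)"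
      proof (rule sum_mono)
        fix q assume q: "q \<in> I - ?Big"
        have "x q \<le> sum x I" using q fin nonneg by (intro member_le_sum) auto
        then have "x q ^ a i \<le> x q ^ 2"
          using q a2[of i] i nonneg sum by (intro power_decreasing) auto
        also have "\<dots> \<le> \<delta> * x q"
          using q nonneg by (auto simp: power2_eq_square intro!: mult_right_mono)
        finally show "x q ^ a i \<le> \<delta> * x q" .
      qed
      also have "\<dots> = \<delta> * sum x (I - ?Big)" by (simp add: sum_distrib_left)
      also have "\<dots> \<le> \<delta> * sum x I"
        using \<delta> fin nonneg by (intro mult_left_mono sum_mono2) auto
      also have "\<dots> \<le> \<delta> * 1" using \<delta> sum by (intro mult_left_mono) auto
      finally show "(\<Sum>q\<in>I - ?Big. x q ^ a i) \<le> \<delta>" by simp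
      show "(\<Prod>j\<in>R - {i}. \<Sum>q\<in>I. x q ^ a j) \<le> 1"
        using fin nonneg sum a1 by (intro prod_le_1 conjI sum_nonneg power_sum_le) auto
      show "0 \<le> (\<Prod>j\<in>R - {i}. \<Sum>q\<in>I. x q ^ a j)"
        using nonneg by (intro prod_nonneg sum_nonneg ballI) auto
    qed fact
    finally show ?thesis by simp
  qed
  have "inj_sum a R I x \<le> (\<Sum>\<phi>\<in>injections R I. \<Sum>i\<in>?R. if \<phi> i \<notin> ?Big then ?g \<phi> else 0)"
    unfolding inj_sum_def
  proof (rule sum_mono)
    fix \<phi> assume \<phi>: "\<phi> \<in> injections R I"
    then obtain i where "i \<in> ?R" "\<phi> i \<notin> ?Big" using missed by blast
    then show "?g \<phi> \<le> (\<Sum>i\<in>?R. if \<phi> i \<notin> ?Big then ?g \<phi> else 0)"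
      using member_le_sum[of i ?R "\<lambda>i. if \<phi> i \<notin> ?Big then ?g \<phi> else 0"] g0[OF \<phi>] fin
      by (auto split: if_splits)
  qed
  also have "\<dots> = (\<Sum>i\<in>?R. \<Sum>\<phi>\<in>injections R I. if \<phi> i \<notin> ?Big then ?g \<phi> else 0)"
    by (rule sum.swap)
  also have "\<dots> \<le> (\<Sum>i\<in>?R. \<delta>)" by (intro sum_mono each)
  also have "\<dots> \<le> real (card R) * \<delta>"
    using \<delta> fin i0 by (auto intro!: mult_right_mono)
  finally show False using large by linarith
qed

lemma power_add_superadditive:
  fixes u v :: real assumes "u \<ge> 0" "v \<ge> 0" "k \<ge> 1"
  shows "u ^ k + v ^ k \<le> (u + v) ^ k"
  using \<open>k \<ge> 1\<close>
proof (induction k rule: dec_induct)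
  case (step k)
  have "u ^ Suc k + v ^ Suc k \<le> (u + v) * (u ^ k + v ^ k)"
    using assms by (simp add: algebra_simps)
  also have "\<dots> \<le> (u + v) * (u + v) ^ k" using assms step by (intro mult_left_mono) auto
  finally show ?case by simp
qed simp

text \<open>
  The two extra terms are the ones that pay for the placements lost when parts of sizes \<open>u\<close> and \<open>v\<close> are
  merged.
\<close>

lemma power_add_gain:
  fixes u v :: real assumes "u \<ge> 0" "v \<ge> 0" "k \<ge> 2"
  shows "u ^ k + v ^ k + (u ^ (k - 1) * v + u * v ^ (k - 1)) \<le> (u + v) ^ k"
proof -
  obtain l where k: "k = Suc l" "l \<ge> 1" using \<open>k \<ge> 2\<close> by (cases k) auto
  have "u ^ k + v ^ k + (u ^ (k - 1) * v + u * v ^ (k - 1)) = (u + v) * (u ^ l + v ^ l)"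
    by (simp add: k algebra_simps)
  also have "\<dots> \<le> (u + v) * (u + v) ^ l"
    using assms k by (intro mult_left_mono power_add_superadditive) auto
  finally show ?thesis by (simp add: k)
qed

text \<open>
  A single injection into the big parts already contributes this much.
\<close>

lemma inj_sum_lower_bound:
  assumes "finite R" "finite J" "Big \<subseteq> J" "card R \<le> card Big"
    and nonneg: "\<And>q. q \<in> J \<Longrightarrow> x q \<ge> 0" and big: "\<And>q. q \<in> Big \<Longrightarrow> x q \<ge> \<delta>" and "\<delta> \<ge> 0"
  shows "\<delta> ^ sum a R \<le> inj_sum a R J x"
proof -
  have "finite Big" using assms finite_subset by blast
  then obtain f where f: "f ` R \<subseteq> Big" "inj_on f R" using assms by (meson card_le_inj)
  then have \<phi>: "restrict f R \<in> injections R J" using assms by (auto simp: injections_def inj_on_def)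
  have "\<delta> ^ sum a R = (\<Prod>i\<in>R. \<delta> ^ a i)" by (simp add: power_sum)
  also have "\<dots> \<le> (\<Prod>i\<in>R. x (restrict f R i) ^ a i)"
    using f big \<open>\<delta> \<ge> 0\<close> by (intro prod_mono conjI power_mono) auto
  also have "\<dots> \<le> inj_sum a R J x"
    unfolding inj_sum_def
  proof (rule member_le_sum[OF \<phi>])
    fix \<phi> assume "\<phi> \<in> injections R J - {restrict f R}"
    then show "(\<Prod>i\<in>R. x (\<phi> i) ^ a i) \<ge> 0"
      using nonneg by (intro prod_nonneg zero_le_power ballI) (auto simp: injections_def)
  qed (use assms in auto)
  finally show ?thesis .
qed

text \<open>
  Let \<open>u\<close> and \<open>v\<close> be the sizes of the two tiny parts. The gain from a part \<open>i \<noteq> i0\<close> of \<open>F\<close> is at least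
  \<open>\<delta> ^ sum a R * G i\<close> with \<open>G i = u ^ (a i - 1) * v + u * v ^ (a i - 1)\<close>. A placement of \<open>i\<close> and \<open>j\<close>
  in the two tiny parts is lost by merging; since \<open>i\<close> or \<open>j\<close> differs from \<open>i0\<close>, it is worth at most
  \<open>\<epsilon> * (G i + G j)\<close>. Summing over all pairs, the loss is at most \<open>2 * card R * \<epsilon>\<close> times the sum of all
  \<open>G i\<close>.
\<close>

lemma inj_sum_merge_tiny_parts:
  assumes fin: "finite R" "finite I" and nonneg: "\<And>q. q \<in> I \<Longrightarrow> x q \<ge> 0" and sum: "sum x I \<le> 1"
    and a1: "\<And>i. i \<in> R \<Longrightarrow> a i \<ge> 1" and a2: "\<And>i. i \<in> R \<Longrightarrow> i \<noteq> i0 \<Longrightarrow> a i \<ge> 2"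
    and Big: "Big \<subseteq> I - {p, q}" "card R - 1 \<le> card Big" "\<And>s. s \<in> Big \<Longrightarrow> x s \<ge> \<delta>"
    and \<delta>: "0 \<le> \<delta>" "\<delta> \<le> 1" and pq: "p \<in> I" "q \<in> I" "p \<noteq> q"
    and tiny: "x p \<le> \<epsilon>" "x q \<le> \<epsilon>" "2 * real (card R) * \<epsilon> \<le> \<delta> ^ sum a R"
  shows "inj_sum a R I x \<le> inj_sum a R (I - {q}) (x(p := x p + x q))"
proof -
  define u v where "u = x p" and "v = x q"
  define G where "G i = (if i = i0 then 0 else u ^ (a i - 1) * v + u * v ^ (a i - 1))" for i
  let ?J = "I - {p, q}"
  let ?B = "\<lambda>i. inj_sum a (R - {i}) ?J x" and ?C = "\<lambda>i j. inj_sum a (R - {i, j}) ?J x"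
  let ?y = "x(p := x p + x q)"
  have uv: "0 \<le> u" "0 \<le> v" "u \<le> \<epsilon>" "v \<le> \<epsilon>" using pq nonneg tiny by (auto simp: u_def v_def)
  have le1: "u \<le> 1" "v \<le> 1"
    using member_le_sum[of p I x] member_le_sum[of q I x] pq fin nonneg sum
    by (auto simp: u_def v_def)
  have \<epsilon>: "\<epsilon> \<ge> 0" using uv by simp
  have G0: "G i \<ge> 0" for i using uv by (simp add: G_def)
  have sumJ: "sum x ?J \<le> 1"
  proof -
    have "sum x ?J \<le> sum x I" using fin nonneg by (intro sum_mono2) auto
    then show ?thesis using sum by simp
  qed
  have C: "0 \<le> ?C i j" "?C i j \<le> 1" for i j
    using fin nonneg a1 sumJ by (auto intro!: inj_sum_nonneg inj_sum_le_1)
  have B: "\<delta> ^ sum a R \<le> ?B i" if "i \<in> R" for i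
  proof -
    have "\<delta> ^ sum a R \<le> \<delta> ^ sum a (R - {i})"
      using \<delta> fin by (intro power_decreasing sum_mono2) auto
    also have "\<dots> \<le> ?B i"
      using fin Big nonneg \<delta> that by (intro inj_sum_lower_bound[where Big = Big]) auto
    finally show ?thesis .
  qed
  have cross: "u ^ a i * v ^ a j * ?C i j \<le> \<epsilon> * (G i + G j)" if ij: "i \<in> R" "j \<in> R" "i \<noteq> j" for i j
  proof -
    have "u ^ a i * v ^ a j * ?C i j \<le> u ^ a i * v ^ a j * 1"
      using C uv by (intro mult_left_mono) auto
    also have "\<dots> \<le> \<epsilon> * (G i + G j)"
    proof (cases "i = i0")
      case False
      have "u ^ a i * v ^ a j \<le> u ^ a i * v"
        using power_decreasing[of 1 "a j" v] uv le1 a1[OF ij(2)] by (intro mult_left_mono) auto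
      also have "\<dots> = u * (u ^ (a i - 1) * v)"
        using a1[OF ij(1)] by (cases "a i") auto
      also have "\<dots> \<le> \<epsilon> * (u ^ (a i - 1) * v)" using uv by (intro mult_right_mono) auto
      also have "\<dots> \<le> \<epsilon> * (G i + G j)"
        using uv \<epsilon> G0[of j] False by (intro mult_left_mono) (auto simp: G_def)
      finally show ?thesis by simp
    next
      case True
      then have j: "j \<noteq> i0" using ij by simp
      have "u ^ a i * v ^ a j \<le> u * v ^ a j"
        using power_decreasing[of 1 "a i" u] uv le1 a1[OF ij(1)] by (intro mult_right_mono) auto
      also have "\<dots> = v * (u * v ^ (a j - 1))"
        using a1[OF ij(2)] by (cases "a j") auto
      also have "\<dots> \<le> \<epsilon> * (u * v ^ (a j - 1))" using uv by (intro mult_right_mono) auto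
      also have "\<dots> \<le> \<epsilon> * (G i + G j)"
        using uv \<epsilon> G0[of i] j by (intro mult_left_mono) (auto simp: G_def)
      finally show ?thesis by simp
    qed
    finally show ?thesis .
  qed
  have gain: "\<delta> ^ sum a R * G i \<le> ((u + v) ^ a i - (u ^ a i + v ^ a i)) * ?B i" if i: "i \<in> R" for i
  proof -
    have "G i \<le> (u + v) ^ a i - (u ^ a i + v ^ a i)"
      using power_add_superadditive[of u v "a i"] power_add_gain[of u v "a i"] a1[OF i] a2[OF i] uv
      by (auto simp: G_def)
    then have "G i * \<delta> ^ sum a R \<le> ((u + v) ^ a i - (u ^ a i + v ^ a i)) * ?B i"
      using B[OF i] \<delta> G0[of i] by (intro mult_mono) auto
    then show ?thesis by (simp add: mult.commute)
  qed
  have "(\<Sum>i\<in>R. \<Sum>j\<in>R - {i}. u ^ a i * v ^ a j * ?C i j) \<le> (\<Sum>i\<in>R. \<Sum>j\<in>R - {i}. \<epsilon> * (G i + G j))"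
    using cross by (intro sum_mono) auto
  also have "\<dots> \<le> (\<Sum>i\<in>R. \<Sum>j\<in>R. \<epsilon> * (G i + G j))"
    using \<epsilon> G0 fin by (intro sum_mono sum_mono2) (auto intro!: mult_nonneg_nonneg add_nonneg_nonneg)
  also have "\<dots> = (\<Sum>i\<in>R. \<epsilon> * (real (card R) * G i + sum G R))"
    by (simp add: sum_distrib_left[symmetric] sum.distrib)
  also have "\<dots> = \<epsilon> * (real (card R) * sum G R + real (card R) * sum G R)"
    by (simp add: sum_distrib_left[symmetric] sum.distrib)
  also have "\<dots> = (2 * real (card R) * \<epsilon>) * sum G R"
    by simp
  also have "\<dots> \<le> \<delta> ^ sum a R * sum G R"
    using tiny G0 by (intro mult_right_mono sum_nonneg) auto
  also have "\<dots> \<le> (\<Sum>i\<in>R. ((u + v) ^ a i - (u ^ a i + v ^ a i)) * ?B i)"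
    unfolding sum_distrib_left by (intro sum_mono gain)
  finally have main: "(\<Sum>i\<in>R. \<Sum>j\<in>R - {i}. u ^ a i * v ^ a j * ?C i j)
      \<le> (\<Sum>i\<in>R. (u + v) ^ a i * ?B i) - (\<Sum>i\<in>R. (u ^ a i + v ^ a i) * ?B i)"
    by (simp add: sum_subtractf left_diff_distrib)
  have J: "I - {q} - {p} = ?J" by auto
  have yJ: "inj_sum a S ?J ?y = inj_sum a S ?J x" for S by (rule inj_sum_cong) auto
  have "inj_sum a R (I - {q}) ?y = inj_sum a R ?J x + (\<Sum>i\<in>R. (u + v) ^ a i * ?B i)"
    using inj_sum_split_part[of R "I - {q}" p a ?y] fin pq unfolding J yJ by (simp add: u_def v_def)
  moreover have "inj_sum a R I x = inj_sum a R ?J x + (\<Sum>i\<in>R. (u ^ a i + v ^ a i) * ?B i)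
      + (\<Sum>i\<in>R. \<Sum>j\<in>R - {i}. u ^ a i * v ^ a j * ?C i j)"
    unfolding u_def v_def by (rule inj_sum_split_two_parts[OF fin pq])
  ultimately show ?thesis using main by linarith
qed

text \<open>
  At most \<open>1 / \<epsilon>\<close> parts are larger than \<open>\<epsilon>\<close>, so among more than \<open>\<lceil>1 / \<epsilon>\<rceil> + 1\<close> parts, two are at most
  \<open>\<epsilon>\<close> and can be merged. The value never drops below \<open>f0\<close>, hence \<open>\<delta>\<close> and \<open>\<epsilon>\<close> stay the same
  throughout.
\<close>

lemma bounded_number_of_parts_suffices:
  assumes R: "finite R" and a1: "\<And>i. i \<in> R \<Longrightarrow> a i \<ge> 1" and i0: "i0 \<in> R"
    and a2: "\<And>i. i \<in> R \<Longrightarrow> i \<noteq> i0 \<Longrightarrow> a i \<ge> 2" and f0: "f0 > 0"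
  obtains L where "\<And>I x. profile I x \<Longrightarrow> inj_sum a R I x \<ge> f0 \<Longrightarrow>
    \<exists>I' x'. profile I' x' \<and> card I' \<le> L \<and> inj_sum a R I x \<le> inj_sum a R I' x'"
proof -
  define r where "r = real (card R)"
  have r: "r > 0" using R i0 by (auto simp: r_def card_gt_0_iff)
  \<comment> \<open>\<open>\<delta>\<close> is small enough for \<open>r * \<delta> < f0\<close>; \<open>\<epsilon>\<close> is below \<open>\<delta>\<close>, so that tiny parts are not big, and small enough to merge.\<close>
  define \<delta> where "\<delta> = min 1 (f0 / (2 * r))"
  define \<epsilon> where "\<epsilon> = min (\<delta> / 2) (\<delta> ^ sum a R / (2 * r))"
  have \<delta>: "0 < \<delta>" "\<delta> \<le> 1" using f0 r by (auto simp: \<delta>_def)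
  have "r * \<delta> \<le> r * (f0 / (2 * r))" using r by (intro mult_left_mono) (auto simp: \<delta>_def)
  also have "\<dots> < f0" using r f0 by (simp add: field_simps)
  finally have r\<delta>: "r * \<delta> < f0" .
  have \<epsilon>: "0 < \<epsilon>" "\<epsilon> < \<delta>" using \<delta> r by (auto simp: \<epsilon>_def min_def)
  have "2 * r * \<epsilon> \<le> 2 * r * (\<delta> ^ sum a R / (2 * r))" using r by (intro mult_left_mono) (auto simp: \<epsilon>_def)
  then have r\<epsilon>: "2 * r * \<epsilon> \<le> \<delta> ^ sum a R" using r by simp
  define L where "L = nat \<lceil>1 / \<epsilon>\<rceil> + 1"
  have "\<exists>I' x'. profile I' x' \<and> card I' \<le> L \<and> inj_sum a R I x \<le> inj_sum a R I' x'"
    if "profile I x" "inj_sum a R I x \<ge> f0" for I x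
    using that
  proof (induction "card I" arbitrary: I x rule: less_induct)
    case less
    have fin: "finite I" and pos: "\<And>q. q \<in> I \<Longrightarrow> x q > 0" and sum: "sum x I = 1"
      using less.prems by (auto simp: profile_def)
    show ?case
    proof (cases "card I \<le> L")
      case True
      then show ?thesis using less.prems by blast
    next
      case False
      let ?K = "{q \<in> I. x q > \<epsilon>}" and ?Big = "{q \<in> I. x q \<ge> \<delta>}"
      have "real (card ?K) * \<epsilon> \<le> sum x ?K"
        using sum_mono[of ?K "\<lambda>_. \<epsilon>" x] by simp
      also have "\<dots> \<le> sum x I" using fin pos by (intro sum_mono2) (auto intro: less_imp_le)
      finally have "real (card ?K) \<le> 1 / \<epsilon>" using \<epsilon> sum by (simp add: field_simps)
      then have K: "card ?K \<le> nat \<lceil>1 / \<epsilon>\<rceil>" by linarith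
      have "card (I - ?K) = card I - card ?K" using fin by (intro card_Diff_subset) auto
      then have "\<not> card (I - ?K) \<le> 1" using False K by (auto simp: L_def)
      then obtain p q where pq: "p \<in> I" "q \<in> I" "p \<noteq> q" and tiny: "x p \<le> \<epsilon>" "x q \<le> \<epsilon>"
        using card_le_Suc0_iff_eq[of "I - ?K"] fin by force
      have "card ?Big \<ge> card R - 1"
        using fin R pos sum a1 a2 i0 \<delta> r\<delta> less.prems(2)
        by (intro many_big_parts[where a = a and ?i0.0 = i0]) (auto simp: r_def intro: less_imp_le)
      moreover have "?Big \<subseteq> I - {p, q}" using tiny \<epsilon> by auto
      ultimately have le: "inj_sum a R I x \<le> inj_sum a R (I - {q}) (x(p := x p + x q))"
        using fin R pos sum a1 a2 \<delta> pq tiny r\<epsilon>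
        by (intro inj_sum_merge_tiny_parts[where Big = ?Big and \<delta> = \<delta> and \<epsilon> = \<epsilon>])
           (auto simp: r_def intro: less_imp_le)
      have "sum (x(p := x p + x q)) (I - {q}) = x p + x q + sum x (I - {q} - {p})"
        using fin pq by (subst sum.remove[of _ p]) (auto intro!: sum.cong)
      also have "\<dots> = 1"
        using sum fin pq by (simp add: sum.remove[of I q] sum.remove[of "I - {q}" p])
      finally have "profile (I - {q}) (x(p := x p + x q))"
        using fin pos pq by (auto simp: profile_def add_pos_pos)
      moreover have "card (I - {q}) < card I" using fin pq by (intro card_Diff1_less)
      ultimately obtain I' x' where "profile I' x'" "card I' \<le> L"
          "inj_sum a R (I - {q}) (x(p := x p + x q)) \<le> inj_sum a R I' x'"
        using less.hyps[of "I - {q}" "x(p := x p + x q)"] le less.prems(2) by auto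
      then show ?thesis using le by (meson order_trans)
    qed
  qed
  then show ?thesis by (rule that)
qed

section \<open>Existence of an optimal profile\<close>

lemma inj_sum_reindex:
  assumes "inj_on g I"
  shows "inj_sum a R (g ` I) x = inj_sum a R I (\<lambda>q. x (g q))"
proof -
  let ?k = "inv_into I g"
  have "(\<Sum>\<phi>\<in>injections R (g ` I). \<Prod>i\<in>R. x (\<phi> i) ^ a i) = (\<Sum>\<phi>\<in>injections R I. \<Prod>i\<in>R. x (g (\<phi> i)) ^ a i)"
  proof (rule sum.reindex_bij_witness[of _ "\<lambda>\<phi>. \<lambda>i\<in>R. g (\<phi> i)" "\<lambda>\<phi>. \<lambda>i\<in>R. ?k (\<phi> i)"], goal_cases)
    case (1 \<phi>)
    then have "\<phi> i \<in> g ` I" if "i \<in> R" for i using that by (auto simp: injections_def)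
    then have "(\<lambda>i\<in>R. g ((\<lambda>i\<in>R. ?k (\<phi> i)) i)) = restrict \<phi> R"
      by (auto simp: f_inv_into_f intro!: restrict_ext)
    then show ?case using 1 by (simp add: injections_def PiE_iff extensional_restrict)
  next
    case (2 \<phi>)
    then have "\<phi> i \<in> g ` I" if "i \<in> R" for i using that by (auto simp: injections_def)
    then show ?case using 2
      by (auto simp: injections_def inj_on_def inv_into_into dest: inv_into_injective)
  next
    case (3 \<phi>)
    then have "\<phi> i \<in> I" if "i \<in> R" for i using that by (auto simp: injections_def)
    then have "(\<lambda>i\<in>R. ?k ((\<lambda>i\<in>R. g (\<phi> i)) i)) = restrict \<phi> R"
      using assms by (auto intro!: restrict_ext)
    then show ?case using 3 by (simp add: injections_def PiE_iff extensional_restrict)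
  next
    case (4 \<phi>)
    then have "\<phi> i \<in> I" if "i \<in> R" for i using that by (auto simp: injections_def)
    then show ?case using 4 assms by (auto simp: injections_def inj_on_def)
  next
    case (5 \<phi>)
    then have "\<phi> i \<in> g ` I" if "i \<in> R" for i using that by (auto simp: injections_def)
    then show ?case by (auto simp: f_inv_into_f intro!: prod.cong)
  qed
  then show ?thesis by (simp add: inj_sum_def)
qed

lemma inj_sum_drop_zeros:
  assumes "finite R" "finite I'" "I \<subseteq> I'" and zero: "\<And>q. q \<in> I' - I \<Longrightarrow> x q = 0"
    and a1: "\<And>i. i \<in> R \<Longrightarrow> a i \<ge> 1"
  shows "inj_sum a R I' x = inj_sum a R I x"
  unfolding inj_sum_def
proof (rule sum.mono_neutral_right)
  show "injections R I \<subseteq> injections R I'" using assms by (auto simp: injections_def PiE_iff)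
  show "\<forall>\<phi>\<in>injections R I' - injections R I. (\<Prod>i\<in>R. x (\<phi> i) ^ a i) = 0"
  proof
    fix \<phi> assume \<phi>: "\<phi> \<in> injections R I' - injections R I"
    then obtain i where i: "i \<in> R" "\<phi> i \<in> I' - I" by (auto simp: injections_def PiE_iff)
    then have "x (\<phi> i) ^ a i = 0" using zero a1[OF i(1)] by (simp add: power_0_left)
    then show "(\<Prod>i\<in>R. x (\<phi> i) ^ a i) = 0" using assms(1) i by (meson prod_zero)
  qed
qed (use assms in auto)

text \<open>
  Profiles with at most \<open>L\<close> parts, padded with parts of size 0. The coordinates from \<open>L\<close> on are pinned
  to 0 to obtain a compact set of functions on all of \<open>nat\<close>.
\<close>

lemma compact_padded_simplex:
  "compact {y :: nat \<Rightarrow> real. (\<forall>i. y i \<in> (if i < L then {0..1} else {0})) \<and> (\<Sum>i<L. y i) = 1}"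
proof -
  let ?B = "\<lambda>i::nat. if i < L then {0..1::real} else {0}"
  have "compactin (product_topology (\<lambda>_. euclidean) UNIV) (PiE UNIV ?B)"
    by (auto simp: compactin_PiE)
  then have "compact (PiE UNIV ?B)" by (simp add: euclidean_product_topology)
  moreover have "closed {y :: nat \<Rightarrow> real. (\<Sum>i<L. y i) = 1}"
    by (intro closed_Collect_eq continuous_intros continuous_on_product_coordinates)
  ultimately have "compact (PiE UNIV ?B \<inter> {y. (\<Sum>i<L. y i) = 1})" by (rule compact_Int_closed)
  moreover have "PiE UNIV B \<inter> {y. P y} = {y. (\<forall>i. y i \<in> B i) \<and> P y}"
    for B :: "nat \<Rightarrow> real set" and P by (auto simp: PiE_iff)
  ultimately show ?thesis by (simp only:)
qed

text \<open>
  No profile exceeds both the uniform profile on \<open>card R\<close> parts and every profile with boundedly many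
  parts, so the maximum over the padded simplex is the maximum over all profiles. Parts of size 0 of the maximizer on the padded
  simplex are dropped afterwards.
\<close>

lemma inj_sum_attains_maximum:
  assumes R: "finite R" and a1: "\<And>i. i \<in> R \<Longrightarrow> a i \<ge> 1" and i0: "i0 \<in> R"
    and a2: "\<And>i. i \<in> R \<Longrightarrow> i \<noteq> i0 \<Longrightarrow> a i \<ge> 2"
  obtains I x where "profile I x" "\<And>I' x'. profile I' x' \<Longrightarrow> inj_sum a R I' x' \<le> inj_sum a R I x"
proof -
  define r where "r = card R"
  have r: "r > 0" using R i0 by (auto simp: r_def card_gt_0_iff)
  \<comment> \<open>The uniform profile supplies a positive lower bound for the supremum.\<close>
  define f0 where "f0 = inj_sum a R {..<r} (\<lambda>_. 1 / real r)"
  have unif: "profile {..<r} (\<lambda>_. 1 / real r)" using r by (simp add: profile_def)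
  have "f0 > 0" unfolding f0_def using R r by (intro inj_sum_pos) (auto simp: r_def)
  then obtain L where L: "\<And>I x. profile I x \<Longrightarrow> inj_sum a R I x \<ge> f0 \<Longrightarrow>
      \<exists>I' x'. profile I' x' \<and> card I' \<le> L \<and> inj_sum a R I x \<le> inj_sum a R I' x'"
    using bounded_number_of_parts_suffices[of R a i0 f0] R a1 i0 a2 by blast
  let ?S = "{y :: nat \<Rightarrow> real. (\<forall>i. y i \<in> (if i < L then {0..1} else {0})) \<and> (\<Sum>i<L. y i) = 1}"
  let ?f = "inj_sum a R {..<L}"
  have pad: "\<exists>y\<in>?S. inj_sum a R I x \<le> ?f y" if Ix: "profile I x" "inj_sum a R I x \<ge> f0" for I x
  proof -
    obtain I' x' where I': "profile I' x'" "card I' \<le> L" and le: "inj_sum a R I x \<le> inj_sum a R I' x'"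
      using L[OF Ix] by blast
    have fin: "finite I'" and pos: "\<And>q. q \<in> I' \<Longrightarrow> x' q > 0" and sum: "sum x' I' = 1"
      using I' by (auto simp: profile_def)
    obtain g where g: "bij_betw g {..<card I'} I'"
      using ex_bij_betw_nat_finite[OF fin] by (auto simp: atLeast0LessThan)
    define y where "y i = (if i < card I' then x' (g i) else 0)" for i
    have gI: "g i \<in> I'" if "i < card I'" for i using bij_betwE[OF g] that by auto
    have "(\<Sum>i<L. y i) = (\<Sum>i<card I'. y i)"
      using I'(2) by (intro sum.mono_neutral_right) (auto simp: y_def)
    also have "\<dots> = (\<Sum>i<card I'. x' (g i))" by (intro sum.cong) (auto simp: y_def)
    also have "\<dots> = sum x' I'" by (rule sum.reindex_bij_betw[OF g])
    finally have sumy: "(\<Sum>i<L. y i) = 1" using sum by simp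
    have "x' q \<le> 1" if "q \<in> I'" for q
      using member_le_sum[of q I' x'] that fin pos sum by (auto intro: less_imp_le)
    then have "y i \<in> (if i < L then {0..1} else {0})" for i
      using gI pos I'(2) by (auto simp: y_def less_imp_le)
    then have yS: "y \<in> ?S" using sumy by blast
    have "inj_sum a R I' x' = inj_sum a R (g ` {..<card I'}) x'"
      using bij_betw_imp_surj_on[OF g] by simp
    also have "\<dots> = inj_sum a R {..<card I'} (\<lambda>q. x' (g q))"
      by (rule inj_sum_reindex[OF bij_betw_imp_inj_on[OF g]])
    also have "\<dots> = inj_sum a R {..<card I'} y" by (rule inj_sum_cong) (auto simp: y_def)
    also have "\<dots> = ?f y"
      using I'(2) R a1 by (intro inj_sum_drop_zeros[symmetric]) (auto simp: y_def)
    finally show ?thesis using yS le by (intro bexI[of _ y]) auto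
  qed
  have cont: "continuous_on ?S ?f"
    unfolding inj_sum_def
    by (intro continuous_intros continuous_on_subset[OF continuous_on_product_coordinates]) auto
  have "?S \<noteq> {}" using pad[OF unif] unfolding f0_def by blast
  from continuous_attains_sup[OF compact_padded_simplex this cont]
  obtain y where y: "y \<in> ?S" and max: "\<forall>z\<in>?S. ?f z \<le> ?f y" ..
  define I where "I = {q. q < L \<and> y q \<noteq> 0}"
  have y0: "y q \<ge> 0" if "q < L" for q
  proof -
    have "y q \<in> (if q < L then {0..1} else {0})" using y by blast
    then show ?thesis using that by simp
  qed
  have "sum y I = (\<Sum>i<L. y i)" by (rule sum.mono_neutral_left) (auto simp: I_def)
  then have "profile I y" using y y0 by (auto simp: profile_def I_def order_less_le)
  moreover have fy: "?f y = inj_sum a R I y"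
    using R a1 by (intro inj_sum_drop_zeros) (auto simp: I_def)
  moreover have "inj_sum a R I' x' \<le> inj_sum a R I y" if "profile I' x'" for I' x'
  proof (cases "inj_sum a R I' x' \<ge> f0")
    case True
    then show ?thesis using pad[OF that] max fy by (metis (no_types, lifting) order_trans)
  next
    case False
    moreover have "f0 \<le> inj_sum a R I y"
      using pad[OF unif] max fy unfolding f0_def by (metis (no_types, lifting) order_refl order_trans)
    ultimately show ?thesis by linarith
  qed
  ultimately show ?thesis using that by blast
qed


section \<open>Optimal part sizes\<close>

lemma profile_nth: "part_sizes x \<Longrightarrow> profile {..<length x} ((!) x)"
  by (auto simp: part_sizes_def profile_def sum_list_sum_nth atLeast0LessThan)

lemma profile_as_list:
  assumes "profile I y"
  obtains x where "part_sizes x" "inj_sum a R {..<length x} ((!) x) = inj_sum a R I y"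
proof -
  let ?s = "sorted_list_of_set I"
  have fin: "finite I" and pos: "\<And>q. q \<in> I \<Longrightarrow> y q > 0" and sum: "sum y I = 1"
    using assms by (auto simp: profile_def)
  have bij: "bij_betw ((!) ?s) {..<length ?s} I"
    using fin by (intro bij_betw_nth) auto
  define x where "x = map y ?s"
  have "sum_list x = sum y I"
    using fin by (simp add: x_def sum_list_distinct_conv_sum_set)
  then have "part_sizes x" using fin pos sum by (auto simp: part_sizes_def x_def)
  moreover have "inj_sum a R {..<length x} ((!) x) = inj_sum a R {..<length ?s} (\<lambda>i. y (?s ! i))"
    by (simp add: x_def) (rule inj_sum_cong, simp)
  moreover have "\<dots> = inj_sum a R ((!) ?s ` {..<length ?s}) y"
    by (rule inj_sum_reindex[symmetric, OF bij_betw_imp_inj_on[OF bij]])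
  ultimately show ?thesis
    using bij_betw_imp_surj_on[OF bij] by (intro that[of x]) auto
qed

lemma strongly_unbalancedD:
  assumes "strongly_unbalanced a" "i < length a" "j < length a" "i \<noteq> j"
  shows "(int (a ! i) - int (a ! j))\<^sup>2 > int (a ! i) + int (a ! j)"
proof (cases "i < j")
  case True
  then show ?thesis using assms by (auto simp: strongly_unbalanced_def)
next
  case False
  then have "(int (a ! j) - int (a ! i))\<^sup>2 > int (a ! j) + int (a ! i)"
    using assms by (auto simp: strongly_unbalanced_def)
  then show ?thesis by (simp add: power2_commute add.commute)
qed

lemma strongly_unbalanced_distinct:
  assumes "strongly_unbalanced a" shows "distinct a"
  unfolding distinct_conv_nth
proof (intro allI impI notI)
  fix i j assume "i < length a" "j < length a" "i \<noteq> j" "a ! i = a ! j"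
  then show False using strongly_unbalancedD[OF assms, of i j] by simp
qed

text \<open>
  Comparison with profiles of \<open>length a\<close> parts shows that \<open>x\<close> has at least as many parts as \<open>F\<close>, since
  the polynomial vanishes otherwise; then the perturbation of two equal parts applies.
\<close>

lemma maximal_profile_distinct:
  assumes len: "length a \<ge> 2" and unb: "strongly_unbalanced a"
    and x: "part_sizes x"
    and max: "\<And>I y. profile I y \<Longrightarrow> card I = length x \<or> card I = length a \<Longrightarrow>
      inj_sum ((!) a) {..<length a} I y \<le> inj_sum ((!) a) {..<length a} {..<length x} ((!) x)"
  shows "distinct x"
proof (rule ccontr)
  assume "\<not> distinct x"
  then obtain p q where pq: "p < length x" "q < length x" "p \<noteq> q" "x ! p = x ! q"
    by (auto simp: distinct_conv_nth)
  let ?R = "{..<length a}" and ?I = "{..<length x}"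
  let ?f = "inj_sum ((!) a) ?R"
  have prof: "profile ?I ((!) x)" by (rule profile_nth[OF x])
  let ?u = "\<lambda>_::nat. 1 / real (length a)"
  have u: "profile ?R ?u" using len by (auto simp: profile_def)
  have "?f ?R ?u > 0" using len by (intro inj_sum_pos) auto
  also have "?f ?R ?u \<le> ?f ?I ((!) x)" using max[OF u] by simp
  finally have "\<not> length x < length a" using inj_sum_eq_0[of ?I ?R "(!) a" "(!) x"] by auto
  then obtain h where h: "0 < h" "h < x ! p"
    and less: "?f ?I ((!) x) < ?f ?I (((!) x)(p := x ! p + h, q := x ! q - h))"
    using inj_sum_less_perturbed[of ?R ?I "(!) a" "(!) x" p q] len pq prof
      strongly_unbalancedD[OF unb] by (auto simp: profile_def)
  let ?y = "((!) x)(p := x ! p + h, q := x ! q - h)"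
  have "sum z ?I = z p + z q + sum z (?I - {p} - {q})" for z :: "nat \<Rightarrow> real"
    using pq by (simp add: sum.remove[of ?I p] sum.remove[of "?I - {p}" q])
  note split = this[of ?y] this[of "(!) x"]
  have "sum ?y (?I - {p} - {q}) = sum ((!) x) (?I - {p} - {q})" by (intro sum.cong) auto
  then have "sum ?y ?I = sum ((!) x) ?I" unfolding split using pq by simp
  then have "profile ?I ?y" using prof h pq by (auto simp: profile_def)
  then have "?f ?I ?y \<le> ?f ?I ((!) x)" by (intro max) auto
  then show False using less by simp
qed

theorem theorem1p12:
  fixes a :: "nat list"
  assumes "length a \<ge> 2"
    and "sorted_wrt (\<ge>) a"
    and "\<forall>t\<in>set a. t \<ge> 1"
    and "strongly_unbalanced a"
  shows "(\<forall>k > length a. \<forall>x.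
            part_sizes x \<and> length x < k \<and>
            graphon_density (complete_partite a) (partite_graphon x) =
              K_free_inducibility k (complete_partite a)
            \<longrightarrow> distinct x) \<and>
         (\<exists>x. part_sizes x \<and>
            graphon_density (complete_partite a) (partite_graphon x) =
              inducibility (complete_partite a)) \<and>
         (\<forall>x. part_sizes x \<and>
            graphon_density (complete_partite a) (partite_graphon x) =
              inducibility (complete_partite a)
            \<longrightarrow> distinct x)"
proof -
  let ?F = "complete_partite a" and ?R = "{..<length a}"
  let ?m = "card (verts ?F)"
  let ?f = "inj_sum ((!) a) ?R"
  define C where "C = real (card (part_maps a {..<?m}))"
  have C: "C > 0" using card_part_maps_pos[of "{..<?m}" a] by (simp add: C_def)
  have density: "colour_density ?F {..<?m} I y = C * ?f I y" for I y
    unfolding C_def using assms(3) strongly_unbalanced_distinct[OF assms(4)]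
    by (intro colour_density_eq_inj_sum) auto
  have graphon: "graphon_density ?F (partite_graphon x) = C * ?f {..<length x} ((!) x)"
    if "part_sizes x" for x
    using graphon_density_eq_colour_density[OF that, of ?F] unfolding density .
  have opt: "distinct x"
    if x: "part_sizes x" and P: "P (length x)" "P (length a)" "P 1"
      and eq: "graphon_density ?F (partite_graphon x) = Sup (profile_densities ?F P)" for x P
  proof (rule maximal_profile_distinct[OF assms(1,4) x])
    fix I y assume I: "profile I y" "card I = length x \<or> card I = length a"
    then have "C * ?f I y \<in> profile_densities ?F P"
      using P unfolding density[symmetric] by (intro profile_densitiesI) auto
    then have "C * ?f I y \<le> C * ?f {..<length x} ((!) x)"
      unfolding graphon[OF x, symmetric] eq
      by (intro cSup_upper profile_densities_bounds[of P, OF P(3)])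
    then show "?f I y \<le> ?f {..<length x} ((!) x)" using C by simp
  qed
  have "distinct x" if "k > length a" "part_sizes x" "length x < k"
    "graphon_density ?F (partite_graphon x) = K_free_inducibility k ?F" for k x
    using that assms(1) by (intro opt[of x "\<lambda>l. l < k"]) (auto simp: K_free_inducibility_eq_Sup)
  moreover have "distinct x" if "part_sizes x"
    "graphon_density ?F (partite_graphon x) = inducibility ?F" for x
    using that by (intro opt[of x "\<lambda>_. True"]) (auto simp: inducibility_eq_Sup)
  moreover have "\<exists>x. part_sizes x \<and> graphon_density ?F (partite_graphon x) = inducibility ?F"
  proof -
    \<comment> \<open>The list is decreasing with distinct entries, so only its last entry can be 1.\<close>
    have a2: "a ! i \<ge> 2" if "i \<in> ?R" "i \<noteq> length a - 1" for i
    proof -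
      have "a ! i \<ge> a ! (length a - 1)"
        using sorted_wrt_nth_less[OF assms(2), of i "length a - 1"] that by auto
      moreover have "a ! i \<noteq> a ! (length a - 1)"
        using strongly_unbalanced_distinct[OF assms(4)] that by (auto simp: nth_eq_iff_index_eq)
      moreover have "a ! (length a - 1) > 0" using nth_pos[OF assms(3)] assms(1) by auto
      ultimately show ?thesis by linarith
    qed
    have a1: "a ! i \<ge> 1" if "i \<in> ?R" for i using nth_pos[OF assms(3), of i] that by auto
    have "length a - 1 \<in> ?R" using assms(1) by auto
    then obtain I y where I: "profile I y"
      and max: "\<And>I' y'. profile I' y' \<Longrightarrow> ?f I' y' \<le> ?f I y"
      using inj_sum_attains_maximum[of ?R "(!) a" "length a - 1"] a1 a2 by blast
    obtain x where x: "part_sizes x" "?f {..<length x} ((!) x) = ?f I y"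
      using profile_as_list[OF I] by blast
    have "Sup (profile_densities ?F (\<lambda>_. True)) = C * ?f I y"
    proof (rule cSup_eq_maximum)
      show "C * ?f I y \<in> profile_densities ?F (\<lambda>_. True)"
        using I unfolding density[symmetric] by (intro profile_densitiesI) auto
      fix z assume "z \<in> profile_densities ?F (\<lambda>_. True)"
      then obtain I' y' where "profile I' y'" "z = C * ?f I' y'"
        unfolding profile_densities_def density by auto
      then show "z \<le> C * ?f I y" using max C by (simp add: mult_left_mono)
    qed
    then show ?thesis using x graphon[OF x(1)] by (intro exI[of _ x]) (simp add: inducibility_eq_Sup)
  qed
  ultimately show ?thesis by blast
qed

end
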